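(* Let $\mathfrak{F}\subseteq\mathfrak{F}_{\mathrm{all}}$ satisfy $\mathfrak{F}\supseteq\mathfrak{F}_{\mathrm{AR}(2)}^{ext}$. Suppose that the polynomial trend assumption holds: $X=(F,\tilde X)$, where $F$ is $n\times k_F$-dimensional ($1\le k_F\le k$) with $j$-th column $(1^{j-1},\ldots,n^{j-1})'$, where $\tilde X$ is an $n\times(k-k_F)$-dimensional matrix such that $X$ has rank $k$ ($\tilde X$ is the empty matrix if $k_F=k$), and the restriction matrix $R$ has a nonzero column $R_{\cdot i}$ for some $i\in\{1,\ldots,k_F\}$. Let $T$ be a nonsphericity-corrected F-type test statistic based on $\check\beta$ and $\check\Omega$, where $(\check\beta,\check\Omega,N)$ satisfies the estimator conditions. Furthermore, assume that for every $v\in\mathbb{R}^q$ with $v\ne0$ we have $\lambda_{\mathbb{R}^n}(\{y\in\mathbb{R}^n\setminus N^*:v'\check\Omega^{-1}(y)v=0\})=0$. Then for every critical value $C$, $-\infty<C<\infty$, for every $\mu_0\in\mathfrak{M}_0$, and for every $\sigma^2\in(0,\infty)$ it holds that $$P_{0,I_n}(\check\Omega\text{ is nonnegative definite})\le P_{0,I_n}(R_{\cdot i_0}'\check\Omega^{-1}R_{\cdot i_0}\ge0)\le\sup_{f\in\mathfrak{F}}P_{\mu_0,\sigma^2\Sigma(f)}(T\ge C),$$ where $R_{\cdot i_0}$ denotes the first nonzero column of $R$.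
   Context: Model: $n,k,q$ are positive integers with $1\le k<n$; $X\in\mathbb{R}^{n\times k}$ is a fixed matrix of rank $k$; $R\in\mathbb{R}^{q\times k}$ has rank $q\ge 1$; $r\in\mathbb{R}^q$. (One tests $R\beta=r$ in $\mathbf{Y}=X\beta+\mathbf{U}$, $\mathbf{U}\sim N(0,\sigma^2\Sigma(f))$, $0<\sigma^2<\infty$, $f\in\mathfrak{F}$.) $'$ is transpose, $\mathfrak{M}_0=\{X\beta:R\beta=r\}$. $P_{\mu,A}$ is the Gaussian measure on $\mathbb{R}^n$ with mean $\mu$ and covariance $A$; $P(T\ge C)$ means $P(\{y:T(y)\ge C\})$, and similarly for events stated in terms of $\check\Omega$ (which is $P_{0,I_n}$-almost everywhere defined and nonsingular). $\lambda_{\mathbb{R}^n}$ is Lebesgue measure. Spectral densities: $\mathfrak{F}_{\mathrm{all}}$ is the set of all normalized spectral densities of real weakly stationary processes (nonnegative, even, integrable $f$ on $[-\pi,\pi]$ with $\int_{-\pi}^{\pi}f=1$); $\mathfrak{F}_{\mathrm{AR}(2)}$ is the subset of those corresponding to stationary autoregressive processes of order at most two; $\mathfrak{F}_{\mathrm{AR}(2)}^{ext}$ is the set of all $c_1f+(2\pi)^{-1}c_2$ with $f\in\mathfrak{F}_{\mathrm{AR}(2)}$, $c_1,c_2\ge0$, $c_1+c_2=1$; $\Sigma(f)=\left[\int_{-\pi}^{\pi}e^{-\iota(j-l)\omega}f(\omega)d\omega\right]_{j,l=1}^n$, $\iota$ the imaginary unit. Estimator conditions on $(\check\beta,\check\Omega,N)$: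 (i) $\check\beta:\mathbb{R}^n\setminus N\to\mathbb{R}^k$ and $\check\Omega:\mathbb{R}^n\setminus N\to\mathbb{R}^{q\times q}$ are well-defined and continuous on $\mathbb{R}^n\setminus N$, where $N$ is a closed $\lambda_{\mathbb{R}^n}$-null set, and $\check\Omega(y)$ is symmetric for every $y\in\mathbb{R}^n\setminus N$; (ii) $y\in\mathbb{R}^n\setminus N$ implies $\delta y+X\eta\in\mathbb{R}^n\setminus N$ for all $\delta\ne0$, $\eta\in\mathbb{R}^k$; (iii) $\check\beta(\delta y+X\eta)=\delta\check\beta(y)+\eta$ and $\check\Omega(\delta y+X\eta)=\delta^2\check\Omega(y)$ for all $y\in\mathbb{R}^n\setminus N$, $\delta\neq0$, $\eta\in\mathbb{R}^k$; (iv) $\check\Omega$ is $\lambda_{\mathbb{R}^n}$-almost everywhere nonsingular on $\mathbb{R}^n\setminus N$. Nonsphericity-corrected F-type test statistic: with $N^*=N\cup\{y\in\mathbb{R}^n\setminus N:\det\check\Omega(y)=0\}$, $T(y)=(R\check\beta(y)-r)'\check\Omega^{-1}(y)(R\check\beta(y)-r)$ for $y\in\mathbb{R}^n\setminus N^*$ and $T(y)=0$ for $y\in N^*$. *)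

theory Defs
  imports "HOL-Analysis.Analysis" "HOL-Library.FuncSet"
begin

text \<open>
  Coordinates of vectors and matrices are indexed by finite linearly ordered types; \<open>idx i\<close> is
  the position of \<open>i\<close>, counted from one, so that the indices correspond to $1,\ldots,n$.
\<close>

definition idx :: "'a::linorder \<Rightarrow> nat" where
  "idx i = card {..i}"

lemma bij_betw_idx: "bij_betw idx (UNIV :: 'a::{finite,linorder} set) {1..CARD('a)}"
proof -
  have mono: "idx i < idx j" if "i < j" for i j :: 'a
    unfolding idx_def using that by (intro psubset_card_mono) auto
  have inj: "inj (idx :: 'a \<Rightarrow> nat)"
    by (rule injI) (metis mono less_irrefl linorder_less_linear)
  have sub: "range (idx :: 'a \<Rightarrow> nat) \<subseteq> {1..CARD('a)}"
  proof
    fix m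
    assume "m \<in> range (idx :: 'a \<Rightarrow> nat)"
    then obtain i :: 'a where m: "m = card {..i}"
      by (auto simp: idx_def)
    have "card {..i} \<le> CARD('a)"
      by (rule card_mono) auto
    moreover have "0 < card {..i}"
      by (auto simp: card_gt_0_iff)
    ultimately show "m \<in> {1..CARD('a)}"
      by (simp add: m)
  qed
  have "card (range (idx :: 'a \<Rightarrow> nat)) = CARD('a)"
    using inj by (rule card_image)
  then have "range (idx :: 'a \<Rightarrow> nat) = {1..CARD('a)}"
    using sub by (intro card_subset_eq) auto
  with inj show ?thesis
    by (simp add: bij_betw_def)
qed


section \<open>Spectral densities\<close>

text \<open>
  Functions on $[-\pi,\pi]$ are represented by extensional functions, so that two of them are equal
  iff they agree on $[-\pi,\pi]$.
\<close>

definition spectral_densities :: "(real \<Rightarrow> real) set" where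
  "spectral_densities = {f \<in> extensional {-pi..pi}.
     (\<forall>\<omega>\<in>{-pi..pi}. 0 \<le> f \<omega> \<and> f (- \<omega>) = f \<omega>) \<and>
     set_integrable lebesgue {-pi..pi} f \<and>
     (LINT \<omega>:{-pi..pi}|lebesgue. f \<omega>) = 1}"

text \<open>
  The autoregression $x_t = a_1 x_{t-1} + a_2 x_{t-2} + \epsilon_t$ with white noise $\epsilon$ of
  variance $s > 0$ has a stationary solution iff the polynomial $1 - a_1 z - a_2 z^2$ has no zero
  on the unit circle. Requiring instead that there are no zeros in the closed unit disc gives the
  same set of spectral densities, as zeros may be reflected at the unit circle.
  Intersecting with \<open>spectral_densities\<close> normalizes the density (and thereby fixes $s$).
\<close>

definition spectral_densities_AR2 :: "(real \<Rightarrow> real) set" where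
  "spectral_densities_AR2 = {f \<in> spectral_densities.
     \<exists>(a1::real) (a2::real) s. s > 0 \<and>
       (\<forall>z::complex. cmod z = 1 \<longrightarrow> 1 - of_real a1 * z - of_real a2 * z\<^sup>2 \<noteq> 0) \<and>
       (\<forall>\<omega>\<in>{-pi..pi}. f \<omega> =
          s / (2 * pi) / (cmod (1 - of_real a1 * cis (- \<omega>) - of_real a2 * cis (- 2 * \<omega>)))\<^sup>2)}"

definition spectral_densities_AR2_ext :: "(real \<Rightarrow> real) set" where
  "spectral_densities_AR2_ext =
     {(\<lambda>\<omega>\<in>{-pi..pi}. c1 * f \<omega> + c2 / (2 * pi)) | f c1 c2.
        f \<in> spectral_densities_AR2 \<and> 0 \<le> c1 \<and> 0 \<le> c2 \<and> c1 + c2 = 1}"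

text \<open>The integral is real because \<open>f\<close> is even.\<close>

definition cov_matrix :: "(real \<Rightarrow> real) \<Rightarrow> real^'n::{finite,linorder}^'n::{finite,linorder}" where
  "cov_matrix f = (\<chi> j l. Re (LINT \<omega>:{-pi..pi}|lebesgue.
     exp (- (\<i> * of_int (int (idx j) - int (idx l)) * of_real \<omega>)) * of_real (f \<omega>)))"


section \<open>Gaussian measures\<close>

text \<open>
  The nondegenerate case: \<open>A\<close> is meant to be symmetric and positive definite. This is the case for
  the identity and for positive multiples of \<open>cov_matrix f\<close>, \<open>f\<close> a spectral density: a nonzero
  trigonometric polynomial has only finitely many zeros on $[-\pi,\pi]$.
\<close>

definition gaussian :: "real^'n \<Rightarrow> real^'n^'n \<Rightarrow> (real^'n) measure" where
  "gaussian \<mu> A = density lborel (\<lambda>y. ennreal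
     (exp (- ((y - \<mu>) \<bullet> (matrix_inv A *v (y - \<mu>))) / 2) / sqrt ((2 * pi) ^ CARD('n) * det A)))"


section \<open>Regression model and test statistic\<close>

definition polynomial_trend :: "nat \<Rightarrow> real^'k::{finite,linorder}^'n::{finite,linorder} \<Rightarrow> bool" where
  "polynomial_trend kF X \<longleftrightarrow>
     (\<forall>t j. idx j \<le> kF \<longrightarrow> X $ t $ j = real (idx t) ^ (idx j - 1))"

definition null_means :: "real^'k^'n \<Rightarrow> real^'k^'q \<Rightarrow> real^'q \<Rightarrow> (real^'n) set" where
  "null_means X R r = {X *v \<beta> | \<beta>. R *v \<beta> = r}"

definition first_nonzero_column :: "real^'k::{finite,linorder}^'q \<Rightarrow> real^'q" where
  "first_nonzero_column R = column (Min {i. column i R \<noteq> 0}) R"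

definition nonneg_definite :: "real^'q^'q \<Rightarrow> bool" where
  "nonneg_definite A \<longleftrightarrow> transpose A = A \<and> (\<forall>v. 0 \<le> v \<bullet> (A *v v))"

text \<open>
  Estimators defined on the complement of \<open>N\<close> are represented by total functions whose values
  on \<open>N\<close> are irrelevant.
\<close>

definition estimator_conditions ::
  "real^'k^'n \<Rightarrow> (real^'n \<Rightarrow> real^'k) \<Rightarrow> (real^'n \<Rightarrow> real^'q^'q) \<Rightarrow> (real^'n) set \<Rightarrow> bool" where
  "estimator_conditions X \<beta> \<Omega> N \<longleftrightarrow>
     closed N \<and> N \<in> null_sets lborel \<and>
     continuous_on (- N) \<beta> \<and> continuous_on (- N) \<Omega> \<and>
     (\<forall>y. y \<notin> N \<longrightarrow> transpose (\<Omega> y) = \<Omega> y) \<and>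
     (\<forall>y \<delta> \<eta>. y \<notin> N \<and> \<delta> \<noteq> 0 \<longrightarrow>
        \<delta> *\<^sub>R y + X *v \<eta> \<notin> N \<and>
        \<beta> (\<delta> *\<^sub>R y + X *v \<eta>) = \<delta> *\<^sub>R \<beta> y + \<eta> \<and>
        \<Omega> (\<delta> *\<^sub>R y + X *v \<eta>) = \<delta>\<^sup>2 *\<^sub>R \<Omega> y) \<and>
     (AE y in lborel. y \<notin> N \<longrightarrow> invertible (\<Omega> y))"

definition Nstar :: "(real^'n \<Rightarrow> real^'q^'q) \<Rightarrow> (real^'n) set \<Rightarrow> (real^'n) set" where
  "Nstar \<Omega> N = N \<union> {y. y \<notin> N \<and> det (\<Omega> y) = 0}"

definition F_type_stat ::
  "real^'k^'q \<Rightarrow> real^'q \<Rightarrow> (real^'n \<Rightarrow> real^'k) \<Rightarrow> (real^'n \<Rightarrow> real^'q^'q) \<Rightarrow> (real^'n) set \<Rightarrow>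
     real^'n \<Rightarrow> real" where
  "F_type_stat R r \<beta> \<Omega> N y =
     (if y \<in> Nstar \<Omega> N then 0
      else (R *v \<beta> y - r) \<bullet> (matrix_inv (\<Omega> y) *v (R *v \<beta> y - r)))"

end

theory Submission
  imports Defs "HOL-Probability.Distributions"
begin

text \<open>
  For small \<open>\<nu>\<close> the process with spectral mass at \<open>\<plusminus>\<nu>\<close> is \<open>A cos (\<nu> t) + B sin (\<nu> t)\<close>, with \<open>A\<close>, \<open>B\<close>
  independent standard normal. It is the limit of normalized AR(2) processes whose roots approach the unit
  circle, and by Taylor expansion its component in direction $t^p$ has order \<open>\<nu>^p\<close>, all higher ones being
  of smaller order. Mix it with white noise whose standard deviation lies between \<open>\<nu>^p\<close> and
  \<open>\<nu>^(p+1)\<close>, where \<open>p + 1\<close> is the index of the first nonzero column \<open>e\<close> of \<open>R\<close>. After rescaling, the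
  observation is white noise \<open>Z\<close>, plus a vanishing error, plus an element of the span of
  \<open>1, t, \<dots>, t^(p-1)\<close>, which equivariance removes because \<open>R\<close> kills these regressors, plus a diverging
  multiple of $t^p$. Hence \<open>T\<close> diverges to infinity wherever \<open>e' \<Omega>\<^sup>-\<^sup>1(Z) e > 0\<close>, and Fatou's lemma,
  applied to the densities in the AR(2) limit and to the events in the limit \<open>\<nu> \<rightarrow> 0\<close>, gives the bound.
\<close>

section \<open>Gaussian measures\<close>

text \<open>The limiting trend process alone has a covariance matrix of rank at most two, hence in
  general a degenerate law, about which a statistic controlled only up to null sets says nothing.
  The noise keeps the limit covariance nonsingular, and it fixes the order of the limits: \<nu> and
  the noise level stay fixed while the AR(2) densities concentrate, and only then \<nu>
  \<rightarrow> 0. The second limit is pathwise: every law is the image of one standard Gaussian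
  \<open>z\<close> under an explicit square root of its covariance matrix, so the trend coefficients
  can be followed for fixed \<open>z\<close>. Cosine has only even powers and sine only odd ones, so
  the parity of \<open>p\<close> decides which of them carries t^p; its coefficient has a nonzero
  limit for \<open>z\<close> off two hyperplanes. Time is centered at the midpoint of 1, ..., n,
  because this makes the two trigonometric vectors orthogonal and the square root explicit.
  Divergence needs a strict inequality where the event has \<open>\<ge>\<close>; the null set
  assumption on the quadratic form closes this gap.\<close>

lemma nn_integral_lborel_slice:
  fixes b :: "'a::euclidean_space"
  assumes b: "b \<in> Basis" and [measurable]: "G \<in> borel_measurable borel"
  shows "(\<integral>\<^sup>+x. G x \<partial>lborel) =
    (\<integral>\<^sup>+k. (\<integral>\<^sup>+y. G ((\<Sum>i\<in>Basis - {b}. k i *\<^sub>R i) + y *\<^sub>R b) \<partial>lborel) \<partial>(\<Pi>\<^sub>M i\<in>Basis - {b}. lborel))"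
proof -
  interpret product_sigma_finite "\<lambda>_::'a. lborel :: real measure"
    by standard
  have B: "insert b (Basis - {b}) = Basis"
    using b by auto
  have "(\<integral>\<^sup>+x. G x \<partial>lborel) = (\<integral>\<^sup>+k. G (\<Sum>i\<in>Basis. k i *\<^sub>R i) \<partial>(\<Pi>\<^sub>M i\<in>insert b (Basis - {b}). lborel))"
    by (subst lborel_eq) (simp add: nn_integral_distr insert_absorb[OF b])
  also have "\<dots> = (\<integral>\<^sup>+k. (\<integral>\<^sup>+y. G (\<Sum>i\<in>Basis. (k(b := y)) i *\<^sub>R i) \<partial>lborel) \<partial>(\<Pi>\<^sub>M i\<in>Basis - {b}. lborel))"
    by (rule product_nn_integral_insert) (simp_all add: insert_absorb[OF b])
  also have "(\<lambda>k y. (\<Sum>i\<in>Basis. (k(b := y)) i *\<^sub>R i)) = (\<lambda>k y. (\<Sum>i\<in>Basis - {b}. k i *\<^sub>R i) + y *\<^sub>R b)"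
    by (auto simp: fun_eq_iff sum.remove[OF finite_Basis b] add.commute intro!: sum.cong)
  finally show ?thesis .
qed

text \<open>On each line parallel to \<open>b\<close> the function \<open>h\<close> is constant, so
  the shear translates that line and preserves its Lebesgue measure.\<close>

lemma nn_integral_lborel_shear:
  fixes b :: "'a::euclidean_space"
  assumes b: "b \<in> Basis" and [measurable]: "g \<in> borel_measurable borel" "h \<in> borel_measurable borel"
    and h: "\<And>x t. h (x + t *\<^sub>R b) = (h x :: real)"
  shows "(\<integral>\<^sup>+x. g (x + h x *\<^sub>R b) \<partial>lborel) = (\<integral>\<^sup>+x. g x \<partial>lborel)"
proof -
  have *: "(\<integral>\<^sup>+y. g (s + y *\<^sub>R b + h (s + y *\<^sub>R b) *\<^sub>R b) \<partial>lborel) = (\<integral>\<^sup>+y. g (s + y *\<^sub>R b) \<partial>lborel)" for s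
    using nn_integral_real_affine[of "\<lambda>y. g (s + y *\<^sub>R b)" 1 "h s"]
    by (simp add: h scaleR_add_left add_ac)
  show ?thesis
    by (subst (1 2) nn_integral_lborel_slice[OF b]) (simp_all add: *)
qed

text \<open>The change of variables formulas of the library need a well-ordered index type.\<close>

lemma nn_integral_lborel_linear:
  fixes f :: "real^'n \<Rightarrow> real^'n"
  assumes "linear f" "g \<in> borel_measurable borel" "det (matrix f) \<noteq> 0"
  shows "(\<integral>\<^sup>+x. g x \<partial>lborel) = ennreal \<bar>det (matrix f)\<bar> * (\<integral>\<^sup>+x. g (f x) \<partial>lborel)"
proof -
  \<comment> \<open>The quantifier over \<open>g\<close> belongs to the induction claim, because the
    composition case applies the claim for \<open>f2\<close> to
    \<open>\<lambda>x. g (f1 x)\<close>.\<close>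
  have "\<forall>g\<in>borel_measurable borel. det (matrix f) \<noteq> 0 \<longrightarrow>
      (\<integral>\<^sup>+x. g x \<partial>lborel) = ennreal \<bar>det (matrix f)\<bar> * (\<integral>\<^sup>+x. g (f x) \<partial>lborel)"
  proof (rule induct_linear_elementary[OF \<open>linear f\<close>]; intro ballI impI)
    fix f1 f2 :: "real^'n \<Rightarrow> real^'n" and g :: "real^'n \<Rightarrow> ennreal"
    assume lin: "linear f1" "linear f2"
      and 1: "\<forall>g\<in>borel_measurable borel. det (matrix f1) \<noteq> 0 \<longrightarrow>
        (\<integral>\<^sup>+x. g x \<partial>lborel) = ennreal \<bar>det (matrix f1)\<bar> * (\<integral>\<^sup>+x. g (f1 x) \<partial>lborel)"
      and 2: "\<forall>g\<in>borel_measurable borel. det (matrix f2) \<noteq> 0 \<longrightarrow>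
        (\<integral>\<^sup>+x. g x \<partial>lborel) = ennreal \<bar>det (matrix f2)\<bar> * (\<integral>\<^sup>+x. g (f2 x) \<partial>lborel)"
      and g [measurable]: "g \<in> borel_measurable borel"
      and nz: "det (matrix (f1 \<circ> f2)) \<noteq> 0"
    have d: "det (matrix (f1 \<circ> f2)) = det (matrix f1) * det (matrix f2)"
      using lin by (simp add: matrix_compose det_mul)
    have [measurable]: "f1 \<in> borel_measurable borel"
      using lin(1) by (intro borel_measurable_continuous_onI linear_continuous_on) (simp add: linear_linear)
    have "(\<integral>\<^sup>+x. g x \<partial>lborel) = ennreal \<bar>det (matrix f1)\<bar> * (\<integral>\<^sup>+x. g (f1 x) \<partial>lborel)"
      by (rule 1[rule_format]) (use nz d in auto)
    also have "(\<integral>\<^sup>+x. g (f1 x) \<partial>lborel) = ennreal \<bar>det (matrix f2)\<bar> * (\<integral>\<^sup>+x. g (f1 (f2 x)) \<partial>lborel)"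
      by (rule 2[rule_format, of "\<lambda>x. g (f1 x)"]) (use nz d in auto)
    finally show "(\<integral>\<^sup>+x. g x \<partial>lborel) = ennreal \<bar>det (matrix (f1 \<circ> f2))\<bar> * (\<integral>\<^sup>+x. g ((f1 \<circ> f2) x) \<partial>lborel)"
      by (simp add: d abs_mult ennreal_mult mult.assoc)
  next
    \<comment> \<open>A map with a vanishing coordinate is not onto, hence not injective, so its
      determinant is zero and the case is vacuous.\<close>
    fix f :: "real^'n \<Rightarrow> real^'n" and i and g :: "real^'n \<Rightarrow> ennreal"
    assume "linear f" and 0: "\<And>x. f x $ i = 0" and "det (matrix f) \<noteq> 0"
    moreover have "\<not> inj f"
      using \<open>linear f\<close> 0 by (metis (full_types) linear_injective_imp_surjective one_neq_zero surjE vec_component)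
    ultimately show "(\<integral>\<^sup>+x. g x \<partial>lborel) = ennreal \<bar>det (matrix f)\<bar> * (\<integral>\<^sup>+x. g (f x) \<partial>lborel)"
      using det_nz_iff_inj[OF \<open>linear f\<close>] by blast
  next
    fix c :: "'n \<Rightarrow> real" and g :: "real^'n \<Rightarrow> ennreal"
    assume [measurable]: "g \<in> borel_measurable borel"
      and nz: "det (matrix (\<lambda>x. \<chi> i. c i * x $ i)) \<noteq> 0"
    have d: "det (matrix (\<lambda>x. \<chi> i. c i * x $ i)) = (\<Prod>i\<in>UNIV. c i)"
      by (subst det_diagonal) (auto simp: matrix_def axis_def)
    with nz have c: "c i \<noteq> 0" for i
      by auto
    define c' where "c' j = (\<Sum>i\<in>UNIV. c i * j $ i)" for j :: "real^'n"
    have c': "c' (axis i 1) = c i" for i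
      by (simp add: c'_def axis_def if_distrib cong: if_cong)
    have B: "(Basis :: (real^'n) set) = range (\<lambda>i. axis i 1)"
      by (auto simp: Basis_vec_def)
    have inj: "inj (\<lambda>i::'n. axis i (1::real))"
      by (simp add: inj_on_def axis_eq_axis)
    have "(\<Sum>j\<in>Basis. (c' j * (x \<bullet> j)) *\<^sub>R j) = (\<Sum>i\<in>UNIV. (c i * x $ i) *\<^sub>R axis i 1)" for x :: "real^'n"
      by (simp add: B sum.reindex[OF inj] c' inner_axis)
    then have T: "(\<Sum>j\<in>Basis. (c' j * (x \<bullet> j)) *\<^sub>R j) = (\<chi> i. c i * x $ i)" for x :: "real^'n"
      by (simp add: vec_eq_iff axis_def if_distrib cong: if_cong)
    have "(\<Prod>j\<in>Basis. \<bar>c' j\<bar>) = \<bar>\<Prod>i\<in>UNIV. c i\<bar>"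
      by (simp add: B prod.reindex[OF inj] c' abs_prod)
    moreover have "c' j \<noteq> 0" if "j \<in> Basis" for j :: "real^'n"
      using that c c' by (auto simp: B)
    ultimately have "lborel = density (distr lborel borel (\<lambda>x. \<chi> i. c i * x $ i)) (\<lambda>_. ennreal \<bar>\<Prod>i\<in>UNIV. c i\<bar>)"
      using lborel_affine_euclidean[of c' 0] by (simp add: T)
    moreover have [measurable]: "(\<lambda>x. \<chi> i. c i * x $ i) \<in> borel_measurable borel"
      by (intro borel_measurable_continuous_onI continuous_intros)
    ultimately have "(\<integral>\<^sup>+x. g x \<partial>lborel) =
        (\<integral>\<^sup>+x. g x \<partial>density (distr lborel borel (\<lambda>x. \<chi> i. c i * x $ i)) (\<lambda>_. ennreal \<bar>\<Prod>i\<in>UNIV. c i\<bar>))"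
      by simp
    also have "\<dots> = ennreal \<bar>\<Prod>i\<in>UNIV. c i\<bar> * (\<integral>\<^sup>+x. g (\<chi> i. c i * x $ i) \<partial>lborel)"
      by (simp add: nn_integral_density nn_integral_distr nn_integral_cmult)
    finally show "(\<integral>\<^sup>+x. g x \<partial>lborel) =
        ennreal \<bar>det (matrix (\<lambda>x. \<chi> i. c i * x $ i))\<bar> * (\<integral>\<^sup>+x. g (\<chi> i. c i * x $ i) \<partial>lborel)"
      unfolding d .
  next
    fix m n :: 'n and g :: "real^'n \<Rightarrow> ennreal"
    assume "m \<noteq> n" and [measurable]: "g \<in> borel_measurable borel"
    let ?h = "\<lambda>v::real^'n. \<chi> i. v $ Transposition.transpose m n i"
    have "(\<chi> i j. if Transposition.transpose m n i = j then 1 else 0) = (\<chi> i j. if j = Transposition.transpose m n i then 1 else (0::real))"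
      by (auto intro!: Cart_lambda_cong)
    then have "matrix ?h = transpose (\<chi> i j. mat 1 $ i $ Transposition.transpose m n j)"
      by (auto simp: matrix_eq transpose_def axis_def mat_def matrix_def)
    then have d: "\<bar>det (matrix ?h)\<bar> = 1"
      by (simp add: det_permute_columns permutes_swap_id sign_swap_id abs_mult)
    have [measurable]: "?h \<in> borel_measurable borel"
      by (intro borel_measurable_continuous_onI continuous_intros)
    \<comment> \<open>Swapping coordinates sends boxes to boxes with the same side lengths in
      another order, and Lebesgue measure is determined by its values on boxes.\<close>
    have "lborel = distr lborel borel ?h"
    proof (rule lborel_eqI)
      fix l u :: "real^'n"
      assume le: "\<And>b. b \<in> Basis \<Longrightarrow> l \<bullet> b \<le> u \<bullet> b"
      have le': "l $ i \<le> u $ i" for i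
        using le[of "axis i 1"] by (auto simp: inner_axis Basis_vec_def)
      have B: "(Basis :: (real^'n) set) = range (\<lambda>i. axis i 1)"
        by (auto simp: Basis_vec_def)
      have inj: "inj (\<lambda>i::'n. axis i (1::real))"
        by (simp add: inj_on_def axis_eq_axis)
      have "?h -` box l u = box (?h l) (?h u)"
        by (auto simp: mem_box_cart) (metis transpose_involutory)+
      then have "emeasure (distr lborel borel ?h) (box l u) = emeasure lborel (box (?h l) (?h u))"
        by (simp add: emeasure_distr)
      also have "\<dots> = ennreal (\<Prod>b\<in>Basis. (?h u - ?h l) \<bullet> b)"
        by (rule emeasure_lborel_box) (auto simp: B inner_axis le')
      also have "(\<Prod>b\<in>Basis. (?h u - ?h l) \<bullet> b) = (\<Prod>i\<in>UNIV. (u - l) $ Transposition.transpose m n i)"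
        by (simp add: B prod.reindex[OF inj] inner_axis)
      also have "\<dots> = (\<Prod>i\<in>UNIV. (u - l) $ i)"
        using prod.permute[OF permutes_swap_id, of m UNIV n "\<lambda>i. (u - l) $ i"] by (simp add: o_def)
      also have "\<dots> = (\<Prod>b\<in>Basis. (u - l) \<bullet> b)"
        by (simp add: B prod.reindex[OF inj] inner_axis)
      finally show "emeasure (distr lborel borel ?h) (box l u) = ennreal (\<Prod>b\<in>Basis. (u - l) \<bullet> b)" .
    qed simp
    then have "(\<integral>\<^sup>+x. g x \<partial>lborel) = (\<integral>\<^sup>+x. g x \<partial>distr lborel borel ?h)"
      by simp
    also have "\<dots> = (\<integral>\<^sup>+x. g (?h x) \<partial>lborel)"
      by (rule nn_integral_distr) simp_all
    finally show "(\<integral>\<^sup>+x. g x \<partial>lborel) = ennreal \<bar>det (matrix ?h)\<bar> * (\<integral>\<^sup>+x. g (?h x) \<partial>lborel)"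
      unfolding d by simp
  next
    fix m n :: 'n and g :: "real^'n \<Rightarrow> ennreal"
    assume mn: "m \<noteq> n" and [measurable]: "g \<in> borel_measurable borel"
    let ?h = "\<lambda>v::real^'n. \<chi> i. if i = m then v $ m + v $ n else v $ i"
    \<comment> \<open>The matrix is the identity with row \<open>n\<close> added to row
      \<open>m\<close>, hence of determinant one; the map is a shear along axis
      \<open>m\<close>.\<close>
    have "matrix ?h = (\<chi> k. if k = m then row m (mat 1) + 1 *s row n (mat 1) else row k (mat 1))"
      by (auto simp: vec_eq_iff matrix_def axis_def row_def mat_def)
    then have d: "det (matrix ?h) = 1"
      using det_row_operation[OF mn, of "mat 1" 1] by simp
    have h: "?h x = x + (x $ n) *\<^sub>R axis m 1" for x
      by (auto simp: vec_eq_iff axis_def)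
    have "(\<integral>\<^sup>+x. g (?h x) \<partial>lborel) = (\<integral>\<^sup>+x. g x \<partial>lborel)"
      unfolding h by (rule nn_integral_lborel_shear) (auto simp: Basis_vec_def axis_def mn[symmetric])
    then show "(\<integral>\<^sup>+x. g x \<partial>lborel) = ennreal \<bar>det (matrix ?h)\<bar> * (\<integral>\<^sup>+x. g (?h x) \<partial>lborel)"
      unfolding d by simp
  qed
  with assms show ?thesis
    by blast
qed

section \<open>Gaussian laws as affine images of the standard one\<close>

lemma matrix_inv_mult:
  fixes A :: "'a::semiring_1^'n^'m"
  assumes "invertible A"
  shows matrix_inv_right: "A ** matrix_inv A = mat 1" and matrix_inv_left: "matrix_inv A ** A = mat 1"
  using someI_ex[OF assms[unfolded invertible_def]] by (simp_all add: matrix_inv_def)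

lemma matrix_inv_eqI:
  fixes A :: "'a::semiring_1^'n^'n"
  assumes "A ** B = mat 1" "B ** A = mat 1"
  shows "matrix_inv A = B"
proof -
  have "invertible A"
    using assms by (auto simp: invertible_def)
  then have "matrix_inv A = matrix_inv A ** (A ** B)"
    by (simp add: assms)
  also have "\<dots> = B"
    using \<open>invertible A\<close> by (simp add: matrix_mul_assoc matrix_inv_left)
  finally show ?thesis .
qed

lemma inner_matrix_vector_left:
  fixes A :: "real^'n^'m"
  shows "(A *v x) \<bullet> y = x \<bullet> (transpose A *v y)"
  by (metis dot_lmul_matrix inner_commute transpose_matrix_vector)

lemma borel_measurable_gaussian_density:
  fixes A :: "real^'n^'n"
  shows "(\<lambda>y. ennreal (exp (- ((y - \<mu>) \<bullet> (matrix_inv A *v (y - \<mu>))) / 2) / sqrt ((2 * pi) ^ CARD('n) * det A)))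
    \<in> borel_measurable borel"
  by (intro measurable_compose[OF _ measurable_ennreal] borel_measurable_divide borel_measurable_const
      borel_measurable_continuous_onI continuous_intros bounded_linear.continuous_on[OF matrix_vector_mul_bounded_linear]) simp

lemma emeasure_gaussian:
  assumes "S \<in> sets borel"
  shows "emeasure (gaussian \<mu> A) S = (\<integral>\<^sup>+y. ennreal (exp (- ((y - \<mu>) \<bullet> (matrix_inv A *v (y - \<mu>))) / 2) /
    sqrt ((2 * pi) ^ CARD('n) * det A)) * indicator S (y :: real^'n) \<partial>lborel)"
  unfolding gaussian_def using assms by (intro emeasure_density) (simp_all only: borel_measurable_gaussian_density sets_lborel measurable_lborel2)

text \<open>Substituting y = \<mu> + L z turns the quadratic form into z \<bullet> z, and the
  Jacobian |det L| cancels the square root of det (L L'). This puts all Gaussian laws on one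
  probability space, where events can be compared pointwise.\<close>

lemma gaussian_congruence:
  fixes L :: "real^'n^'n"
  assumes L: "invertible L"
  shows "gaussian \<mu> (L ** transpose L) = distr (gaussian 0 (mat 1)) borel (\<lambda>z. \<mu> + L *v z)"
proof (rule measure_eqI)
  fix S
  assume "S \<in> sets (gaussian \<mu> (L ** transpose L))"
  then have [measurable]: "S \<in> sets borel"
    by (simp add: gaussian_def)
  let ?A = "L ** transpose L"
  let ?d = "\<lambda>\<mu> A y. exp (- ((y - \<mu>) \<bullet> (matrix_inv A *v (y - \<mu>))) / 2) / sqrt ((2 * pi) ^ CARD('n) * det A)"
  have LT: "invertible (transpose L)"
    using L by (simp add: invertible_det_nz)
  have A: "invertible ?A"
    using L LT by (simp add: invertible_det_nz det_mul)
  have detL: "det L \<noteq> 0"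
    using L by (simp add: invertible_det_nz)
  let ?P = "transpose L ** matrix_inv ?A ** L"
  have "?P = ?P ** (transpose L ** matrix_inv (transpose L))"
    by (simp add: matrix_inv_right[OF LT])
  also have "\<dots> = transpose L ** (matrix_inv ?A ** ?A) ** matrix_inv (transpose L)"
    by (simp only: matrix_mul_assoc)
  also have "\<dots> = mat 1"
    by (simp add: matrix_inv_left[OF A] matrix_inv_right[OF LT])
  finally have inv: "?P = mat 1" .
  have quad: "(L *v z) \<bullet> (matrix_inv ?A *v (L *v z)) = z \<bullet> z" for z
  proof -
    have "(L *v z) \<bullet> (matrix_inv ?A *v (L *v z)) = z \<bullet> (?P *v z)"
      by (simp only: inner_matrix_vector_left matrix_vector_mul_assoc matrix_mul_assoc)
    then show ?thesis
      by (simp add: inv)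
  qed
  note [measurable] = borel_measurable_gaussian_density
  have [measurable]: "(\<lambda>z. \<mu> + L *v z) \<in> borel_measurable borel"
    by (intro borel_measurable_continuous_onI continuous_intros)
  have "emeasure (gaussian \<mu> ?A) S = (\<integral>\<^sup>+y. ennreal (?d \<mu> ?A y) * indicator S y \<partial>lborel)"
    by (rule emeasure_gaussian) measurable
  also have "\<dots> = (\<integral>\<^sup>+y. ennreal (?d \<mu> ?A y) * indicator S y \<partial>distr lborel borel ((+) \<mu>))"
    by (simp add: lborel_distr_plus)
  also have "\<dots> = (\<integral>\<^sup>+y. ennreal (?d \<mu> ?A (\<mu> + y)) * indicator S (\<mu> + y) \<partial>lborel)"
    by (rule nn_integral_distr) measurable
  also have "\<dots> = ennreal \<bar>det L\<bar> * (\<integral>\<^sup>+z. ennreal (?d \<mu> ?A (\<mu> + L *v z)) * indicator S (\<mu> + L *v z) \<partial>lborel)"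
    by (subst nn_integral_lborel_linear[of "(*v) L" "\<lambda>y. ennreal (?d \<mu> ?A (\<mu> + y)) * indicator S (\<mu> + y)"])
      (measurable, simp_all only: matrix_of_matrix_vector_mul detL matrix_vector_mul_linear not_False_eq_True)
  also have "\<dots> = (\<integral>\<^sup>+z. ennreal \<bar>det L\<bar> * (ennreal (?d \<mu> ?A (\<mu> + L *v z)) * indicator S (\<mu> + L *v z)) \<partial>lborel)"
    by (rule nn_integral_cmult[symmetric]) measurable
  also have "\<dots> = (\<integral>\<^sup>+z. ennreal (?d 0 (mat 1) z) * indicator ((\<lambda>z. \<mu> + L *v z) -` S) z \<partial>lborel)"
  proof (rule nn_integral_cong)
    fix z
    have "\<bar>det L\<bar> * ?d \<mu> ?A (\<mu> + L *v z) = ?d 0 (mat 1) z"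
      using detL matrix_inv_eqI[of "mat 1 :: real^'n^'n" "mat 1"]
      by (simp add: quad det_mul real_sqrt_mult)
    then show "ennreal \<bar>det L\<bar> * (ennreal (?d \<mu> ?A (\<mu> + L *v z)) * indicator S (\<mu> + L *v z)) =
        ennreal (?d 0 (mat 1) z) * indicator ((\<lambda>z. \<mu> + L *v z) -` S) z"
      by (simp add: mult.assoc[symmetric] ennreal_mult'[symmetric] indicator_def)
  qed
  also have "\<dots> = emeasure (gaussian 0 (mat 1)) ((\<lambda>z. \<mu> + L *v z) -` S)"
    by (rule emeasure_gaussian[symmetric, OF measurable_sets_borel]) measurable
  also have "\<dots> = emeasure (distr (gaussian 0 (mat 1)) borel (\<lambda>z. \<mu> + L *v z)) S"
    by (subst emeasure_distr) (auto simp: gaussian_def)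
  finally show "emeasure (gaussian \<mu> ?A) S = emeasure (distr (gaussian 0 (mat 1)) borel (\<lambda>z. \<mu> + L *v z)) S" .
qed (simp add: gaussian_def)

text \<open>The density is a product of one-dimensional standard normal densities, so its mass is a
  product of ones.\<close>

lemma prob_space_std_gaussian: "prob_space (gaussian 0 (mat 1 :: real^'n^'n))"
proof
  have "matrix_inv (mat 1 :: real^'n^'n) = mat 1"
    by (simp add: matrix_inv_eqI)
  then have "emeasure (gaussian 0 (mat 1 :: real^'n^'n)) (space (gaussian 0 (mat 1 :: real^'n^'n))) =
      (\<integral>\<^sup>+y. ennreal (exp (- ((y :: real^'n) \<bullet> y) / 2) / sqrt ((2 * pi) ^ CARD('n))) \<partial>lborel)"
    by (simp add: gaussian_def emeasure_density)
  also have "\<dots> = (\<integral>\<^sup>+y. (\<Prod>b\<in>Basis. ennreal (std_normal_density ((y :: real^'n) \<bullet> b))) \<partial>lborel)"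
  proof (rule nn_integral_cong)
    fix y :: "real^'n"
    have "exp (- (y \<bullet> y) / 2) = (\<Prod>b\<in>Basis. exp (- (y \<bullet> b)\<^sup>2 / 2))"
      by (subst euclidean_inner) (simp add: exp_sum[symmetric] sum_negf sum_divide_distrib power2_eq_square)
    then have "exp (- (y \<bullet> y) / 2) / sqrt ((2 * pi) ^ CARD('n)) = (\<Prod>b\<in>Basis. std_normal_density (y \<bullet> b))"
      by (simp add: std_normal_density_def prod.distrib prod_dividef real_sqrt_power[symmetric] power_one_over)
    then show "ennreal (exp (- (y \<bullet> y) / 2) / sqrt ((2 * pi) ^ CARD('n))) =
        (\<Prod>b\<in>Basis. ennreal (std_normal_density (y \<bullet> b)))"
      by (simp add: prod_ennreal)
  qed
  also have "\<dots> = (\<Prod>b\<in>(Basis :: (real^'n) set). (\<integral>\<^sup>+x. ennreal (std_normal_density x) \<partial>lborel))"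
    by (rule nn_integral_lborel_prod) auto
  also have "(\<integral>\<^sup>+x. ennreal (std_normal_density x) \<partial>lborel) = 1"
    using prob_space.emeasure_space_1[OF prob_space_normal_density[of 1 0]]
    by (simp add: emeasure_density)
  finally show "emeasure (gaussian 0 (mat 1 :: real^'n^'n)) (space (gaussian 0 (mat 1 :: real^'n^'n))) = 1"
    by simp
qed

text \<open>Gram-Schmidt for the inner product x' A y, phrased by maximality: an orthonormal set of
  greatest cardinality spans, since otherwise the normalized residual of a vector outside its span
  could be added. Its elements are the columns of \<open>M\<close>.\<close>

lemma exists_congruence_to_identity:
  fixes A :: "real^'n^'n"
  assumes sym: "transpose A = A" and pos: "\<And>x. x \<noteq> 0 \<Longrightarrow> 0 < x \<bullet> (A *v x)"
  shows "\<exists>M :: real^'n^'n. transpose M ** A ** M = mat 1"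
proof -
  define q where "q x y = x \<bullet> (A *v y)" for x y
  have q_sym: "q x y = q y x" for x y
    unfolding q_def by (metis inner_commute inner_matrix_vector_left sym)
  have q_sum: "q x (\<Sum>s\<in>S. c s *\<^sub>R s) = (\<Sum>s\<in>S. c s * q x s)" for x c and S :: "(real^'n) set"
    by (simp add: q_def linear_sum[OF matrix_vector_mul_linear] inner_sum_right linear_scale[OF matrix_vector_mul_linear])
  define P where "P S \<longleftrightarrow> finite S \<and> (\<forall>x\<in>S. \<forall>y\<in>S. q x y = of_bool (x = y))" for S
  have indep: "independent S" if "P S" for S
  proof -
    have "c x = 0" if "x \<in> S" and 0: "(\<Sum>s\<in>S. c s *\<^sub>R s) = 0" for c x
    proof -
      have "0 = q x (\<Sum>s\<in>S. c s *\<^sub>R s)"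
        by (simp add: 0 q_def)
      also have "\<dots> = (\<Sum>s\<in>S. if s = x then c s else 0)"
        unfolding q_sum using \<open>P S\<close> \<open>x \<in> S\<close> by (intro sum.cong) (auto simp: P_def)
      also have "\<dots> = c x"
        using \<open>P S\<close> \<open>x \<in> S\<close> by (simp add: P_def)
      finally show ?thesis ..
    qed
    then show ?thesis
      using \<open>P S\<close> by (auto simp: independent_explicit_module P_def dependent_finite)
  qed
  have bound: "card S \<le> CARD('n)" if "P S" for S
    using independent_bound[OF indep[OF that]] by simp
  have "P {}"
    by (simp add: P_def)
  \<comment> \<open>Orthonormal sets are independent, so the dimension bounds their cardinality and
    a largest one exists.\<close>
  then have "\<exists>S. P S \<and> (\<forall>S'. P S' \<longrightarrow> card S' \<le> card S)"
    by (rule ex_has_greatest_nat[of P _ card "Suc CARD('n)"]) (use bound in \<open>auto simp: less_Suc_eq_le\<close>)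
  then obtain S where S: "P S" and max: "\<And>S'. P S' \<Longrightarrow> card S' \<le> card S"
    by blast
  have "span S = UNIV"
  proof (rule ccontr)
    assume "span S \<noteq> UNIV"
    then obtain v where v: "v \<notin> span S"
      by auto
    define u where "u = v - (\<Sum>s\<in>S. q s v *\<^sub>R s)"
    have "u \<noteq> 0"
      using v span_sum[of S "\<lambda>s. q s v *\<^sub>R s" S] by (auto simp: u_def span_base span_scale)
    then have quu: "0 < q u u"
      using pos by (simp add: q_def)
    have orth: "q s u = 0" if "s \<in> S" for s
    proof -
      have "q s u = q s v - q s (\<Sum>s\<in>S. q s v *\<^sub>R s)"
        by (simp add: u_def q_def matrix_vector_mult_diff_distrib inner_diff_right)
      also have "q s (\<Sum>s\<in>S. q s v *\<^sub>R s) = (\<Sum>t\<in>S. if t = s then q t v else 0)"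
        unfolding q_sum using S that by (intro sum.cong) (auto simp: P_def)
      also have "\<dots> = q s v"
        using S that by (simp add: P_def)
      finally show ?thesis by simp
    qed
    define u' where "u' = (1 / sqrt (q u u)) *\<^sub>R u"
    have q_scale: "q x (c *\<^sub>R y) = c * q x y" for x y c
      by (simp add: q_def linear_scale[OF matrix_vector_mul_linear])
    have orth': "q s u' = 0" "q u' s = 0" if "s \<in> S" for s
      using orth[OF that] by (simp_all add: u'_def q_scale q_sym[of "_ *\<^sub>R _" s])
    have "q u' u' = 1"
      using quu by (simp add: u'_def q_scale q_sym[of "_ *\<^sub>R _" u])
    moreover have "u' \<notin> S"
      using orth'(1)[of u'] calculation by auto
    ultimately have "P (insert u' S)"
      using S orth' by (auto simp: P_def)
    with max[of "insert u' S"] S \<open>u' \<notin> S\<close> show False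
      by (simp add: P_def)
  qed
  then have "card S = CARD('n)"
    using indep[OF S] by (metis DIM_cart DIM_real dim_UNIV dim_eq_card nat_mult_1_right span_UNIV)
  then obtain b where b: "bij_betw b (UNIV :: 'n set) S"
    using S finite_same_card_bij[of "UNIV :: 'n set" S] by (auto simp: P_def)
  define M where "M = (\<chi> i j. b j $ i)"
  have "(transpose M ** A ** M) $ i $ j = q (b i) (b j)" for i j
  proof -
    have M: "M *v axis j 1 = b j" for j
      by (simp add: M_def vec_eq_iff matrix_vector_mult_basis column_def)
    have "(transpose M ** A ** M) $ i $ j = axis i 1 \<bullet> ((transpose M ** A ** M) *v axis j 1)"
      by (simp add: matrix_vector_mult_basis column_def inner_axis')
    also have "\<dots> = (M *v axis i 1) \<bullet> (A *v (M *v axis j 1))"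
      by (simp only: inner_matrix_vector_left matrix_vector_mul_assoc matrix_mul_assoc)
    finally show ?thesis
      by (simp add: M q_def)
  qed
  moreover have "q (b i) (b j) = of_bool (i = j)" for i j
    using b S by (auto simp: P_def bij_betw_def inj_on_def)
  ultimately have "transpose M ** A ** M = mat 1"
    by (simp add: vec_eq_iff mat_def of_bool_def)
  then show ?thesis ..
qed

lemma positive_definite_factorization:
  fixes A :: "real^'n^'n"
  assumes "transpose A = A" "\<And>x. x \<noteq> 0 \<Longrightarrow> 0 < x \<bullet> (A *v x)"
  obtains L :: "real^'n^'n" where "invertible L" "A = L ** transpose L"
proof -
  have "\<exists>M :: real^'n^'n. transpose M ** A ** M = mat 1"
    by (rule exists_congruence_to_identity) (use assms in auto)
  then obtain M :: "real^'n^'n" where M: "transpose M ** A ** M = mat 1"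
    by blast
  then have inv: "invertible M"
    by (auto simp: invertible_left_inverse)
  let ?B = "matrix_inv M"
  have T: "transpose ?B ** transpose M = mat 1"
    using matrix_inv_right[OF inv] by (metis matrix_transpose_mul transpose_mat)
  have "A = (transpose ?B ** transpose M) ** A ** (M ** ?B)"
    by (simp add: T matrix_inv_right[OF inv])
  also have "\<dots> = transpose ?B ** (transpose M ** A ** M) ** ?B"
    by (simp only: matrix_mul_assoc)
  finally have "A = transpose ?B ** transpose (transpose ?B)"
    by (simp add: M)
  moreover have "invertible (transpose ?B)"
    using T matrix_left_right_inverse by (auto simp: invertible_def)
  ultimately show ?thesis
    using that by blast
qed

text \<open>A zero of a nonnegative form is a minimum, where the gradient 2 A x vanishes: a nonzero
  A x would give a direction of descent, and det A \<noteq> 0 excludes A x = 0.\<close>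

lemma nonneg_definite_pos:
  fixes A :: "real^'n^'n"
  assumes "nonneg_definite A" "det A \<noteq> 0" "x \<noteq> 0"
  shows "0 < x \<bullet> (A *v x)"
proof (rule ccontr)
  assume "\<not> 0 < x \<bullet> (A *v x)"
  with assms(1) have x0: "x \<bullet> (A *v x) = 0"
    by (metis nonneg_definite_def not_less order_antisym)
  define y where "y = A *v x"
  have x0': "x \<bullet> y = 0"
    using x0 by (simp add: y_def)
  have "y \<noteq> 0"
    using assms(2,3) unfolding y_def
    by (metis invertible_det_nz matrix_inv_left matrix_vector_mul_assoc matrix_vector_mul_lid matrix_vector_mult_0_right)
  then have yy: "0 < y \<bullet> y"
    by simp
  have xy: "x \<bullet> (A *v y) = y \<bullet> y"
    using assms(1) by (metis inner_matrix_vector_left nonneg_definite_def y_def)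
  define a where "a = y \<bullet> (A *v y)"
  have a: "0 \<le> a"
    using assms(1) by (simp add: a_def nonneg_definite_def)
  have q: "0 \<le> - 2 * t * (y \<bullet> y) + t\<^sup>2 * a" for t
  proof -
    have "0 \<le> (x - t *\<^sub>R y) \<bullet> (A *v (x - t *\<^sub>R y))"
      using assms(1) by (simp add: nonneg_definite_def)
    also have "\<dots> = - 2 * t * (y \<bullet> y) + t\<^sup>2 * a"
      by (simp add: matrix_vector_mult_diff_distrib linear_scale[OF matrix_vector_mul_linear] inner_diff_left
          inner_diff_right x0' xy a_def power2_eq_square y_def[symmetric] algebra_simps)
    finally show ?thesis .
  qed
  show False
  proof (cases "a = 0")
    case True
    then show False
      using q[of 1] yy by simp
  next
    case False
    with a have "0 < a" by simp
    \<comment> \<open>This t minimizes the quadratic polynomial in \<open>q\<close>; the minimum -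
      (y \<bullet> y)^2 / a is negative.\<close>
    then show False
      using q[of "(y \<bullet> y) / a"] mult_pos_pos[OF yy yy] by (simp add: power2_eq_square field_simps)
  qed
qed

text \<open>Supplies the upper bound without which the real supremum over spectral densities would
  be unspecified.\<close>

lemma emeasure_gaussian_le_1:
  fixes A :: "real^'n^'n"
  assumes "nonneg_definite A"
  shows "emeasure (gaussian \<mu> A) S \<le> 1"
proof -
  have "emeasure (gaussian \<mu> A) S \<le> emeasure (gaussian \<mu> A) (space (gaussian \<mu> A))"
    by (rule emeasure_space)
  also have "\<dots> \<le> 1"
  proof (cases "det A = 0")
    \<comment> \<open>With det A = 0 the density divides by sqrt 0; as division by zero yields zero,
      this is the zero measure.\<close>
    case True
    then show ?thesis
      by (simp add: gaussian_def emeasure_density)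
  next
    case False
    obtain L :: "real^'n^'n" where L: "invertible L" "A = L ** transpose L"
      using positive_definite_factorization nonneg_definite_pos assms False
      by (metis nonneg_definite_def)
    interpret prob_space "gaussian 0 (mat 1 :: real^'n^'n)"
      by (rule prob_space_std_gaussian)
    have "(\<lambda>z. \<mu> + L *v z) \<in> borel_measurable (gaussian 0 (mat 1))"
      by (simp add: gaussian_def) (intro borel_measurable_continuous_onI continuous_intros)
    then have "prob_space (gaussian \<mu> A)"
      unfolding L(2) gaussian_congruence[OF L(1)] by (rule prob_space_distr)
    then show ?thesis
      by (simp add: prob_space.emeasure_space_1)
  qed
  finally show ?thesis .
qed

section \<open>Continuity in the covariance matrix\<close>

lemma tendsto_det:
  fixes A :: "'b \<Rightarrow> real^'n^'n"
  assumes "(A \<longlongrightarrow> L) F"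
  shows "((\<lambda>x. det (A x)) \<longlongrightarrow> det L) F"
  unfolding det_def by (intro tendsto_sum tendsto_mult tendsto_const tendsto_prod tendsto_vec_nth assms)

lemma tendsto_matrix_inv_mult:
  fixes A :: "'b \<Rightarrow> real^'n^'n"
  assumes A: "(A \<longlongrightarrow> L) F" and v: "(v \<longlongrightarrow> w) F" and L: "det L \<noteq> 0"
  shows "((\<lambda>x. matrix_inv (A x) *v v x) \<longlongrightarrow> matrix_inv L *v w) F"
proof -
  \<comment> \<open>Cramer's rule writes each coordinate as a quotient of determinants, which depend
    continuously on the entries.\<close>
  have cramer': "matrix_inv B *v b = (\<chi> k. det (\<chi> i j. if j = k then b $ i else B $ i $ j) / det B)"
    if "det B \<noteq> 0" for B :: "real^'n^'n" and b
  proof -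
    have "B *v (matrix_inv B *v b) = b"
      using that by (simp add: matrix_vector_mul_assoc matrix_inv_right invertible_det_nz)
    then show ?thesis
      using cramer[OF that] by blast
  qed
  have "eventually (\<lambda>x. det (A x) \<noteq> 0) F"
    using tendsto_det[OF A] L by (rule tendsto_imp_eventually_ne)
  then have "eventually (\<lambda>x. (\<chi> k. det (\<chi> i j. if j = k then v x $ i else A x $ i $ j) / det (A x)) = matrix_inv (A x) *v v x) F"
    by eventually_elim (simp add: cramer')
  moreover have "((\<lambda>x. \<chi> k. det (\<chi> i j. if j = k then v x $ i else A x $ i $ j) / det (A x)) \<longlongrightarrow>
      (\<chi> k. det (\<chi> i j. if j = k then w $ i else L $ i $ j) / det L)) F"
  proof (intro tendsto_vec_lambda tendsto_divide tendsto_det A L)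
    show "((\<lambda>x. if j = k then v x $ i else A x $ i $ j) \<longlongrightarrow> (if j = k then w $ i else L $ i $ j)) F" for i j k
      using A v by (auto intro!: tendsto_intros)
  qed
  ultimately show ?thesis
    unfolding cramer'[OF L, symmetric] by (rule Lim_transform_eventually[rotated])
qed

text \<open>The densities converge pointwise because det L \<noteq> 0, and Fatou's lemma passes the
  bound \<open>s\<close> on to the limit.\<close>

lemma emeasure_gaussian_limit_le:
  fixes A :: "nat \<Rightarrow> real^'n^'n"
  assumes A: "A \<longlonglongrightarrow> L" and L: "det L \<noteq> 0" and S: "S \<in> sets borel"
    and le: "\<And>m. emeasure (gaussian \<mu> (A m)) S \<le> s"
  shows "emeasure (gaussian \<mu> L) S \<le> s"
proof -
  let ?d = "\<lambda>B y. ennreal (exp (- ((y - \<mu>) \<bullet> (matrix_inv B *v (y - \<mu>))) / 2) / sqrt ((2 * pi) ^ CARD('n) * det B))"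
  note [measurable] = borel_measurable_gaussian_density S
  have g: "emeasure (gaussian \<mu> B) S = (\<integral>\<^sup>+y. ?d B y * indicator S y \<partial>lborel)" for B
    using S by (rule emeasure_gaussian)
  have lim: "(\<lambda>m. ?d (A m) y * indicator S y) \<longlonglongrightarrow> ?d L y * indicator S y" for y
  proof -
    have "(\<lambda>m. ?d (A m) y) \<longlonglongrightarrow> ?d L y"
      using L by (intro tendsto_ennrealI tendsto_intros tendsto_matrix_inv_mult tendsto_det A) auto
    then show ?thesis
      by (auto simp: indicator_def)
  qed
  have "emeasure (gaussian \<mu> L) S = (\<integral>\<^sup>+y. liminf (\<lambda>m. ?d (A m) y * indicator S y) \<partial>lborel)"
    unfolding g using lim_imp_Liminf[OF _ lim] by simp
  also have "\<dots> \<le> liminf (\<lambda>m. \<integral>\<^sup>+y. ?d (A m) y * indicator S y \<partial>lborel)"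
    by (rule nn_integral_liminf) measurable
  also have "\<dots> \<le> s"
    unfolding g[symmetric] using le by (intro Liminf_le) auto
  finally show ?thesis .
qed

section \<open>The test statistic\<close>

lemma continuous_on_matrix_inv_mult:
  fixes \<Omega> :: "'a::topological_space \<Rightarrow> real^'n^'n"
  assumes "continuous_on S \<Omega>" "continuous_on S v" "\<And>y. y \<in> S \<Longrightarrow> det (\<Omega> y) \<noteq> 0"
  shows "continuous_on S (\<lambda>y. matrix_inv (\<Omega> y) *v v y)"
  using assms unfolding continuous_on_def by (auto intro: tendsto_matrix_inv_mult)

lemma closed_Nstar:
  assumes "closed N" "continuous_on (- N) \<Omega>"
  shows "closed (Nstar \<Omega> N)"
proof -
  have "continuous_on (- N) (\<lambda>y. det (\<Omega> y))"
    using assms(2) unfolding continuous_on_def by (auto intro: tendsto_det)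
  then have "open (- N \<inter> (\<lambda>y. det (\<Omega> y)) -` (- {0}))"
    using assms(1) by (intro continuous_open_preimage) auto
  moreover have "- N \<inter> (\<lambda>y. det (\<Omega> y)) -` (- {0}) = - Nstar \<Omega> N"
    by (auto simp: Nstar_def)
  ultimately show ?thesis
    by (simp add: closed_def)
qed

lemma continuous_on_Nstar_inv:
  assumes "continuous_on (- N) \<Omega>" "continuous_on (- Nstar \<Omega> N) v"
  shows "continuous_on (- Nstar \<Omega> N) (\<lambda>y. matrix_inv (\<Omega> y) *v v y)"
  using assms by (intro continuous_on_matrix_inv_mult) (auto simp: Nstar_def elim: continuous_on_subset)

lemma borel_measurable_F_type_stat:
  assumes "closed N" "continuous_on (- N) \<beta>" "continuous_on (- N) \<Omega>"
  shows "F_type_stat R r \<beta> \<Omega> N \<in> borel_measurable borel"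
proof -
  have \<beta>: "continuous_on (- Nstar \<Omega> N) \<beta>"
    using assms(2) by (rule continuous_on_subset) (auto simp: Nstar_def)
  have "continuous_on (- Nstar \<Omega> N) (\<lambda>y. (R *v \<beta> y - r) \<bullet> (matrix_inv (\<Omega> y) *v (R *v \<beta> y - r)))"
    by (intro continuous_on_Nstar_inv assms continuous_intros \<beta>
        bounded_linear.continuous_on[OF matrix_vector_mul_bounded_linear])
  then show ?thesis
    unfolding F_type_stat_def
    by (intro borel_measurable_continuous_on_if borel_closed closed_Nstar assms) auto
qed

lemma borel_inv_quadratic_form_nonneg:
  assumes "closed N" "continuous_on (- N) \<Omega>"
  shows "{y. y \<notin> Nstar \<Omega> N \<and> 0 \<le> e \<bullet> (matrix_inv (\<Omega> y) *v e)} \<in> sets borel"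
proof -
  have "continuous_on (- Nstar \<Omega> N) (\<lambda>y. e \<bullet> (matrix_inv (\<Omega> y) *v e))"
    by (intro continuous_on_Nstar_inv assms continuous_intros)
  \<comment> \<open>The value -1 on \<open>Nstar\<close> keeps these points out of the set where the
    function is nonnegative.\<close>
  then have [measurable]: "(\<lambda>y. if y \<in> Nstar \<Omega> N then - 1 else e \<bullet> (matrix_inv (\<Omega> y) *v e)) \<in> borel_measurable borel"
    by (intro borel_measurable_continuous_on_if borel_closed closed_Nstar assms) auto
  have "{y. y \<notin> Nstar \<Omega> N \<and> 0 \<le> e \<bullet> (matrix_inv (\<Omega> y) *v e)} =
      {y \<in> space borel. 0 \<le> (if y \<in> Nstar \<Omega> N then - 1 else e \<bullet> (matrix_inv (\<Omega> y) *v e))}"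
    by auto
  then show ?thesis by simp
qed

lemma AE_gaussian:
  assumes "AE y in lborel. P y"
  shows "AE y in gaussian \<mu> A. P y"
  unfolding gaussian_def using assms by (subst AE_density) (auto simp only: borel_measurable_gaussian_density measurable_lborel2 elim: eventually_mono)

lemma nonneg_definite_matrix_inv:
  fixes A :: "real^'n^'n"
  assumes "nonneg_definite A" "det A \<noteq> 0"
  shows "0 \<le> e \<bullet> (matrix_inv A *v e)"
proof -
  let ?x = "matrix_inv A *v e"
  have "A *v ?x = e"
    using assms(2) by (simp add: matrix_vector_mul_assoc matrix_inv_right invertible_det_nz)
  then have "e \<bullet> ?x = ?x \<bullet> (A *v ?x)"
    by (simp add: inner_commute)
  then show ?thesis
    using assms(1) by (simp add: nonneg_definite_def)
qed

text \<open>R \<beta> - r scales with s and \<Omega> with s^2, so s cancels. A regression component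
  acts only through \<open>w\<close>: the part of \<theta> in the kernel of \<open>R\<close> leaves
  no trace.\<close>

lemma F_type_stat_equivariance:
  assumes est: "estimator_conditions X \<beta> \<Omega> N"
    and z: "z \<notin> Nstar \<Omega> N" and s: "s \<noteq> 0" and \<theta>: "R *v \<theta> = r + s *\<^sub>R w"
  shows "F_type_stat R r \<beta> \<Omega> N (s *\<^sub>R z + X *v \<theta>) = (R *v \<beta> z + w) \<bullet> (matrix_inv (\<Omega> z) *v (R *v \<beta> z + w))"
proof -
  let ?y = "s *\<^sub>R z + X *v \<theta>"
  have "z \<notin> N" and inv: "invertible (\<Omega> z)"
    using z by (auto simp: Nstar_def invertible_det_nz)
  then have y: "?y \<notin> N" and \<beta>: "\<beta> ?y = s *\<^sub>R \<beta> z + \<theta>" and \<Omega>: "\<Omega> ?y = s\<^sup>2 *\<^sub>R \<Omega> z"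
    using est s unfolding estimator_conditions_def by blast+
  have l: "(s\<^sup>2 *\<^sub>R \<Omega> z) ** ((1 / s\<^sup>2) *\<^sub>R matrix_inv (\<Omega> z)) = mat 1"
    "((1 / s\<^sup>2) *\<^sub>R matrix_inv (\<Omega> z)) ** (s\<^sup>2 *\<^sub>R \<Omega> z) = mat 1"
    using s inv by (simp_all add: matrix_scalar_ac matrix_inv_left matrix_inv_right)
  then have "matrix_inv (\<Omega> ?y) = (1 / s\<^sup>2) *\<^sub>R matrix_inv (\<Omega> z)" "invertible (\<Omega> ?y)"
    unfolding \<Omega> by (rule matrix_inv_eqI) (auto simp: invertible_def intro: l)
  moreover have "R *v \<beta> ?y - r = s *\<^sub>R (R *v \<beta> z + w)"
    unfolding \<beta> by (simp add: \<theta> matrix_vector_right_distrib linear_scale[OF matrix_vector_mul_linear] algebra_simps)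
  ultimately show ?thesis
    using y s unfolding F_type_stat_def
    by (simp add: Nstar_def invertible_det_nz linear_scale[OF matrix_vector_mul_linear] scaleR_matrix_vector_assoc[symmetric] power2_eq_square)
qed

text \<open>Divided by \<open>l\<close>, the vector is \<open>e\<close> plus a vanishing term, so
  the form is l^2 times a quantity that tends to the positive value of the form at
  \<open>e\<close>.\<close>

lemma quadratic_form_diverges:
  fixes \<Omega> :: "'a::t2_space \<Rightarrow> real^'q^'q" and l :: "nat \<Rightarrow> real"
  assumes S: "open S" "z \<in> S" and v: "continuous_on S v" and \<Omega>: "continuous_on S \<Omega>" "det (\<Omega> z) \<noteq> 0"
    and pos: "0 < e \<bullet> (matrix_inv (\<Omega> z) *v e)"
    and lim: "y \<longlonglongrightarrow> z" "filterlim l at_infinity sequentially"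
  shows "eventually (\<lambda>m. C \<le> (v (y m) + l m *\<^sub>R e) \<bullet> (matrix_inv (\<Omega> (y m)) *v (v (y m) + l m *\<^sub>R e))) sequentially"
proof -
  have "isCont v z" "isCont \<Omega> z"
    using S v \<Omega>(1) by (simp_all add: continuous_on_eq_continuous_at)
  then have lims: "(\<lambda>m. v (y m)) \<longlonglongrightarrow> v z" "(\<lambda>m. \<Omega> (y m)) \<longlonglongrightarrow> \<Omega> z"
    using lim(1) by (auto intro: isCont_tendsto_compose)
  define u where "u m = inverse (l m) *\<^sub>R v (y m) + e" for m
  have "u \<longlonglongrightarrow> 0 *\<^sub>R v z + e"
    unfolding u_def using lim(2) by (intro tendsto_intros lims filterlim_compose[OF tendsto_inverse_0])
  then have u: "u \<longlonglongrightarrow> e"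
    by simp
  have "(\<lambda>m. u m \<bullet> (matrix_inv (\<Omega> (y m)) *v u m)) \<longlonglongrightarrow> e \<bullet> (matrix_inv (\<Omega> z) *v e)"
    by (intro tendsto_intros tendsto_matrix_inv_mult u lims \<Omega>)
  then have "filterlim (\<lambda>m. (u m \<bullet> (matrix_inv (\<Omega> (y m)) *v u m)) * (l m * l m)) at_top sequentially"
    using pos
  proof (rule filterlim_tendsto_pos_mult_at_top)
    have "filterlim (\<lambda>m. norm (l m) * norm (l m)) at_top sequentially"
      using lim(2) unfolding filterlim_at_infinity_conv_norm_at_top by (intro filterlim_at_top_mult_at_top)
    then show "filterlim (\<lambda>m. l m * l m) at_top sequentially"
      by simp
  qed
  then have "eventually (\<lambda>m. C \<le> (u m \<bullet> (matrix_inv (\<Omega> (y m)) *v u m)) * (l m * l m)) sequentially"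
    by (simp add: filterlim_at_top)
  moreover have "eventually (\<lambda>m. l m \<noteq> 0) sequentially"
    using lim(2) by (rule filterlim_at_infinity_imp_eventually_ne)
  ultimately show ?thesis
  proof eventually_elim
    case (elim m)
    have "v (y m) + l m *\<^sub>R e = l m *\<^sub>R u m"
      using elim(2) by (simp add: u_def scaleR_right_distrib)
    then show ?case
      using elim(1) by (simp add: linear_scale[OF matrix_vector_mul_linear] mult_ac)
  qed
qed

text \<open>Fatou's lemma for events: at a point that eventually lies in every \<open>B k\<close>,
  the lower limit of the indicators is one.\<close>

lemma emeasure_le_eventually:
  assumes A: "A \<in> sets M" and B: "\<And>k::nat. B k \<in> sets M"
    and ev: "AE z in M. z \<in> A \<longrightarrow> eventually (\<lambda>k. z \<in> B k) sequentially"
    and le: "\<And>k. emeasure M (B k) \<le> s"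
  shows "emeasure M A \<le> s"
proof -
  note [measurable] = A B
  have "emeasure M A = (\<integral>\<^sup>+z. indicator A z \<partial>M)"
    by simp
  also have "\<dots> \<le> (\<integral>\<^sup>+z. liminf (\<lambda>k. indicator (B k) z) \<partial>M)"
  proof (rule nn_integral_mono_AE)
    show "AE z in M. indicator A z \<le> liminf (\<lambda>k. indicator (B k) z :: ennreal)"
      using ev
    proof eventually_elim
      case (elim z)
      show ?case
      proof (cases "z \<in> A")
        case True
        with elim have "eventually (\<lambda>k. 1 \<le> (indicator (B k) z :: ennreal)) sequentially"
          by (auto elim: eventually_mono)
        then have "1 \<le> liminf (\<lambda>k. indicator (B k) z :: ennreal)"
          by (rule Liminf_bounded)
        with True show ?thesis by simp
      qed simp
    qed
  qed
  also have "\<dots> \<le> liminf (\<lambda>k. \<integral>\<^sup>+z. indicator (B k) z \<partial>M)"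
    by (rule nn_integral_liminf) measurable
  also have "\<dots> \<le> s"
    using le by (intro Liminf_le) auto
  finally show ?thesis .
qed

section \<open>Trigonometric trends in white noise\<close>

definition centered :: "'n::{finite,linorder} \<Rightarrow> real" where
  "centered t = real (idx t) - (real CARD('n) + 1) / 2"

definition cos_vec :: "real \<Rightarrow> real^'n::{finite,linorder}" where
  "cos_vec \<nu> = (\<chi> t. cos (\<nu> * centered t))"

definition sin_vec :: "real \<Rightarrow> real^'n::{finite,linorder}" where
  "sin_vec \<nu> = (\<chi> t. sin (\<nu> * centered t))"

text \<open>The centering makes the cosine vector even and the sine vector odd under time reversal.\<close>

lemma cos_vec_orthogonal_sin_vec: "cos_vec \<nu> \<bullet> (sin_vec \<nu> :: real^'n::{finite,linorder}) = 0"
proof -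
  let ?g = "\<lambda>i. cos (\<nu> * (real i - (real CARD('n) + 1) / 2)) * sin (\<nu> * (real i - (real CARD('n) + 1) / 2))"
  have "cos_vec \<nu> \<bullet> (sin_vec \<nu> :: real^'n::{finite,linorder}) = (\<Sum>t\<in>UNIV. ?g (idx (t :: 'n::{finite,linorder})))"
    by (simp add: inner_vec_def cos_vec_def sin_vec_def centered_def)
  also have "\<dots> = (\<Sum>i=1..CARD('n). ?g i)"
    by (rule sum.reindex_bij_betw[OF bij_betw_idx])
  finally have eq: "cos_vec \<nu> \<bullet> (sin_vec \<nu> :: real^'n::{finite,linorder}) = (\<Sum>i=1..CARD('n). ?g i)" .
  have "(\<Sum>i=1..CARD('n). ?g i) = (\<Sum>i=1..CARD('n). ?g (CARD('n) + 1 - i))"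
    by (rule sum.atLeastAtMost_rev)
  also have "\<dots> = (\<Sum>i=1..CARD('n). - ?g i)"
  proof (rule sum.cong)
    fix i assume "i \<in> {1..CARD('n)}"
    then have "\<nu> * (real (CARD('n) + 1 - i) - (real CARD('n) + 1) / 2) = - (\<nu> * (real i - (real CARD('n) + 1) / 2))"
      by (simp add: of_nat_diff field_simps)
    then show "?g (CARD('n) + 1 - i) = - ?g i"
      by simp
  qed simp
  finally show ?thesis
    by (simp add: eq sum_negf)
qed

section \<open>An explicit square root of the mixture covariance\<close>

text \<open>The matrix \<gamma>^2 I + (1 - \<gamma>^2) v v' has eigenvalue \<gamma>^2 + (1 -
  \<gamma>^2) (v \<bullet> v) at \<open>v\<close>. The gain is the weight of v v' that, added to
  \<gamma> I, produces the square root of this eigenvalue. For v = 0 division by zero makes it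
  0.\<close>

definition rank1_gain :: "real \<Rightarrow> real^'n \<Rightarrow> real" where
  "rank1_gain \<gamma> v = (sqrt (\<gamma>\<^sup>2 + (1 - \<gamma>\<^sup>2) * (v \<bullet> v)) - \<gamma>) / (v \<bullet> v)"

text \<open>
  The two vectors are orthogonal eigenvectors of the covariance matrix of the mixture, so that its
  symmetric square root is a multiple of the identity plus two rank-one terms.
\<close>

definition trend_root :: "real \<Rightarrow> real \<Rightarrow> real^'n::{finite,linorder}^'n::{finite,linorder}" where
  "trend_root \<nu> \<gamma> = (\<chi> i j. \<gamma> * of_bool (i = j)
     + rank1_gain \<gamma> (cos_vec \<nu> :: real^'n::{finite,linorder}) * (cos_vec \<nu> $ i * cos_vec \<nu> $ j)
     + rank1_gain \<gamma> (sin_vec \<nu> :: real^'n::{finite,linorder}) * (sin_vec \<nu> $ i * sin_vec \<nu> $ j))"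

lemma trend_root_mult:
  "trend_root \<nu> \<gamma> *v (z :: real^'n::{finite,linorder}) = \<gamma> *\<^sub>R z
     + (rank1_gain \<gamma> (cos_vec \<nu> :: real^'n::{finite,linorder}) * (cos_vec \<nu> \<bullet> z)) *\<^sub>R cos_vec \<nu>
     + (rank1_gain \<gamma> (sin_vec \<nu> :: real^'n::{finite,linorder}) * (sin_vec \<nu> \<bullet> z)) *\<^sub>R sin_vec \<nu>"
  by (simp add: vec_eq_iff matrix_vector_mult_def trend_root_def distrib_left distrib_right sum.distrib inner_vec_def
      sum_distrib_left sum_distrib_right mult_ac of_bool_def if_distrib[of "\<lambda>x. _ * x"] cong: if_cong)

lemma rank1_gain_nonneg:
  assumes "0 \<le> \<gamma>" "\<gamma> \<le> 1"
  shows "0 \<le> rank1_gain \<gamma> v"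
proof -
  have "0 \<le> (1 - \<gamma>\<^sup>2) * (v \<bullet> v)"
    using assms by (simp add: power_le_one)
  then have "\<gamma> \<le> sqrt (\<gamma>\<^sup>2 + (1 - \<gamma>\<^sup>2) * (v \<bullet> v))"
    by (intro real_le_rsqrt) simp
  then show ?thesis
    by (simp add: rank1_gain_def)
qed

text \<open>This is the equation in g under which (\<gamma> I + g v v')^2 = \<gamma>^2 I + (1 -
  \<gamma>^2) v v'.\<close>

lemma rank1_gain_eq:
  assumes "0 \<le> \<gamma>" "\<gamma> \<le> 1" "v \<noteq> 0"
  shows "2 * \<gamma> * rank1_gain \<gamma> v + (rank1_gain \<gamma> v)\<^sup>2 * (v \<bullet> v) = 1 - \<gamma>\<^sup>2"
proof -
  define S where "S = sqrt (\<gamma>\<^sup>2 + (1 - \<gamma>\<^sup>2) * (v \<bullet> v))"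
  have "0 \<le> (1 - \<gamma>\<^sup>2) * (v \<bullet> v)"
    using assms by (simp add: power_le_one)
  then have S2: "S\<^sup>2 = \<gamma>\<^sup>2 + (1 - \<gamma>\<^sup>2) * (v \<bullet> v)"
    by (simp add: S_def)
  have vv: "v \<bullet> v \<noteq> 0"
    using assms by simp
  have "2 * \<gamma> * rank1_gain \<gamma> v + (rank1_gain \<gamma> v)\<^sup>2 * (v \<bullet> v) = (S\<^sup>2 - \<gamma>\<^sup>2) / (v \<bullet> v)"
    using vv unfolding rank1_gain_def S_def[symmetric]
    by (simp add: divide_simps power2_eq_square) (simp add: algebra_simps)
  then show ?thesis
    using vv by (simp add: S2)
qed

text \<open>The root is at most \<gamma> + |v|, so the gain is at most 1 / |v| and Cauchy-Schwarz
  applies. The bound is uniform in \<gamma> and \<open>v\<close>, hence both trend coefficients stay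
  bounded even when the sine vector shrinks to zero.\<close>

lemma abs_rank1_gain_le:
  assumes "0 \<le> \<gamma>" "\<gamma> \<le> 1"
  shows "\<bar>rank1_gain \<gamma> v * (v \<bullet> z)\<bar> \<le> norm z"
proof (cases "v = 0")
  case False
  have "sqrt (\<gamma>\<^sup>2 + (1 - \<gamma>\<^sup>2) * (v \<bullet> v)) \<le> \<gamma> + norm v"
  proof (rule real_le_lsqrt)
    have "(1 - \<gamma>\<^sup>2) * (v \<bullet> v) \<le> 1 * (v \<bullet> v)"
      by (intro mult_right_mono) auto
    moreover have "0 \<le> 2 * \<gamma> * norm v"
      using assms by simp
    ultimately show "\<gamma>\<^sup>2 + (1 - \<gamma>\<^sup>2) * (v \<bullet> v) \<le> (\<gamma> + norm v)\<^sup>2"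
      by (simp add: power2_sum power2_norm_eq_inner)
  qed (use assms in auto)
  then have "rank1_gain \<gamma> v \<le> norm v / (v \<bullet> v)"
    unfolding rank1_gain_def by (intro divide_right_mono) auto
  also have "\<dots> = 1 / norm v"
    using False by (simp add: power2_norm_eq_inner[symmetric] power2_eq_square)
  finally have "rank1_gain \<gamma> v * \<bar>v \<bullet> z\<bar> \<le> 1 / norm v * (norm v * norm z)"
    using rank1_gain_nonneg[OF assms, of v] by (intro mult_mono Cauchy_Schwarz_ineq2) auto
  then show ?thesis
    using False rank1_gain_nonneg[OF assms, of v] by (simp add: abs_mult)
qed simp

text \<open>The addition formula splits the cosine kernel into u u' + w w' with the two
  trigonometric vectors, whose orthogonality removes the cross terms; each rank-one term is then
  squared by \<open>rank1_gain_eq\<close>. The right-hand side is the covariance of spectral mass 1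
  - \<gamma>^2 at \<plusminus>\<nu> plus white noise of variance \<gamma>^2.\<close>

lemma trend_root_square:
  assumes "0 \<le> \<gamma>" "\<gamma> \<le> 1"
  shows "trend_root \<nu> \<gamma> ** transpose (trend_root \<nu> \<gamma>) =
    (1 - \<gamma>\<^sup>2) *\<^sub>R (\<chi> j l. cos (\<nu> * (real (idx j) - real (idx l)))) + \<gamma>\<^sup>2 *\<^sub>R (mat 1 :: real^'n::{finite,linorder}^'n::{finite,linorder})"
    (is "?L ** _ = ?S")
proof -
  let ?u = "cos_vec \<nu> :: real^'n::{finite,linorder}" and ?w = "sin_vec \<nu> :: real^'n::{finite,linorder}"
  let ?a = "rank1_gain \<gamma> ?u" and ?b = "rank1_gain \<gamma> ?w"
  have sym: "transpose ?L = ?L"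
    by (simp add: trend_root_def transpose_def vec_eq_iff mult_ac eq_commute)
  have uw: "?u \<bullet> ?w = 0" "?w \<bullet> ?u = 0"
    using cos_vec_orthogonal_sin_vec[of \<nu>, where 'n='n] by (simp_all add: inner_commute)
  have S: "?S *v z = \<gamma>\<^sup>2 *\<^sub>R z + ((1 - \<gamma>\<^sup>2) * (?u \<bullet> z)) *\<^sub>R ?u + ((1 - \<gamma>\<^sup>2) * (?w \<bullet> z)) *\<^sub>R ?w" for z
  proof -
    have cos: "cos (\<nu> * (real (idx j) - real (idx l))) = ?u $ j * ?u $ l + ?w $ j * ?w $ l" for j l :: 'n
      using cos_diff[of "\<nu> * centered j" "\<nu> * centered l"]
      by (simp add: cos_vec_def sin_vec_def centered_def algebra_simps)
    have "(\<chi> j l. cos (\<nu> * (real (idx j) - real (idx l)))) *v z = (?u \<bullet> z) *\<^sub>R ?u + (?w \<bullet> z) *\<^sub>R ?w"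
      unfolding cos
      by (simp add: vec_eq_iff matrix_vector_mult_def inner_vec_def distrib_left distrib_right sum.distrib sum_distrib_left sum_distrib_right mult_ac)
    then show ?thesis
      by (simp add: matrix_vector_mult_add_rdistrib scaleR_matrix_vector_assoc[symmetric] scaleR_right_distrib add_ac)
  qed
  have gain: "(2 * \<gamma> * rank1_gain \<gamma> v + (rank1_gain \<gamma> v)\<^sup>2 * (v \<bullet> v)) *\<^sub>R v = (1 - \<gamma>\<^sup>2) *\<^sub>R v" for v :: "(real, 'n) vec"
    using rank1_gain_eq[OF assms, of v] by (cases "v = 0") auto
  have "(?L ** ?L) *v z = ?S *v z" for z
  proof -
    have "?u \<bullet> (?L *v z) = (\<gamma> + ?a * (?u \<bullet> ?u)) * (?u \<bullet> z)" "?w \<bullet> (?L *v z) = (\<gamma> + ?b * (?w \<bullet> ?w)) * (?w \<bullet> z)"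
      by (simp_all add: trend_root_mult inner_add_right uw algebra_simps)
    then have "?L *v (?L *v z) = \<gamma>\<^sup>2 *\<^sub>R z
        + (?u \<bullet> z) *\<^sub>R ((2 * \<gamma> * ?a + ?a\<^sup>2 * (?u \<bullet> ?u)) *\<^sub>R ?u)
        + (?w \<bullet> z) *\<^sub>R ((2 * \<gamma> * ?b + ?b\<^sup>2 * (?w \<bullet> ?w)) *\<^sub>R ?w)"
      unfolding trend_root_mult[of \<nu> \<gamma> "?L *v z"]
      by (simp only:) (simp add: trend_root_mult[of \<nu> \<gamma> z] vec_eq_iff power2_eq_square algebra_simps)
    then show ?thesis
      unfolding gain by (simp add: matrix_vector_mul_assoc[symmetric] S mult_ac)
  qed
  then show ?thesis
    unfolding sym by (subst matrix_eq) blast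
qed

text \<open>The rank-one terms are nonnegative, so the noise term alone bounds the quadratic form
  below by \<gamma> (z \<bullet> z).\<close>

lemma invertible_trend_root:
  assumes "0 < \<gamma>" "\<gamma> \<le> 1"
  shows "invertible (trend_root \<nu> \<gamma> :: real^'n::{finite,linorder}^'n::{finite,linorder})"
proof -
  let ?L = "trend_root \<nu> \<gamma> :: real^'n::{finite,linorder}^'n::{finite,linorder}"
  have "z = 0" if "?L *v z = 0" for z
  proof -
    have "0 = z \<bullet> (?L *v z)"
      using that by simp
    also have "\<dots> = \<gamma> * (z \<bullet> z) + rank1_gain \<gamma> (cos_vec \<nu> :: real^'n::{finite,linorder}) * (cos_vec \<nu> \<bullet> z)\<^sup>2
        + rank1_gain \<gamma> (sin_vec \<nu> :: real^'n::{finite,linorder}) * (sin_vec \<nu> \<bullet> z)\<^sup>2"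
      unfolding trend_root_mult by (simp add: inner_add_right power2_eq_square inner_commute)
    also have "\<dots> \<ge> \<gamma> * (z \<bullet> z)"
      using assms by (simp add: add_nonneg_nonneg mult_nonneg_nonneg rank1_gain_nonneg)
    finally have "z \<bullet> z \<le> 0"
      using assms by (simp add: mult_le_0_iff)
    then show ?thesis
      using inner_gt_zero_iff[of z] by linarith
  qed
  then show ?thesis
    by (simp add: invertible_left_inverse matrix_left_invertible_ker)
qed

section \<open>Taylor expansion and limits of the trend coefficients\<close>

text \<open>The expression does not change when \<open>v\<close> and \<gamma> are both divided by
  \<open>d\<close>, with the factor 1 - \<gamma>^2 kept. A vector that shrinks to zero can thus be
  renormalized, provided the noise is small compared with \<open>d\<close>; only its limit direction
  matters.\<close>

lemma tendsto_rank1_gain: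
  fixes v :: "'b \<Rightarrow> real^'n"
  assumes v: "((\<lambda>x. v x /\<^sub>R d x) \<longlongrightarrow> w) F" and w: "w \<noteq> 0" and d: "\<And>x. 0 < d x"
    and \<gamma>: "(\<gamma> \<longlongrightarrow> 0) F" "((\<lambda>x. \<gamma> x / d x) \<longlongrightarrow> 0) F"
  shows "((\<lambda>x. rank1_gain (\<gamma> x) (v x) * (v x \<bullet> z)) \<longlongrightarrow> (w \<bullet> z) / norm w) F"
proof -
  let ?v = "\<lambda>x. v x /\<^sub>R d x"
  have "rank1_gain (\<gamma> x) (v x) * (v x \<bullet> z) =
      (sqrt ((\<gamma> x / d x)\<^sup>2 + (1 - (\<gamma> x)\<^sup>2) * (?v x \<bullet> ?v x)) - \<gamma> x / d x) / (?v x \<bullet> ?v x) * (?v x \<bullet> z)" for x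
  proof -
    have d: "d x \<noteq> 0" "0 < d x"
      using d[of x] by auto
    have vv: "?v x \<bullet> ?v x = (v x \<bullet> v x) / (d x)\<^sup>2" and vz: "?v x \<bullet> z = (v x \<bullet> z) / d x"
      by (simp_all add: divide_inverse power2_eq_square mult_ac)
    have "(\<gamma> x / d x)\<^sup>2 + (1 - (\<gamma> x)\<^sup>2) * (?v x \<bullet> ?v x) = ((\<gamma> x)\<^sup>2 + (1 - (\<gamma> x)\<^sup>2) * (v x \<bullet> v x)) / (d x)\<^sup>2"
      unfolding vv by (simp add: power_divide add_divide_distrib)
    then have S: "sqrt ((\<gamma> x / d x)\<^sup>2 + (1 - (\<gamma> x)\<^sup>2) * (?v x \<bullet> ?v x)) = sqrt ((\<gamma> x)\<^sup>2 + (1 - (\<gamma> x)\<^sup>2) * (v x \<bullet> v x)) / d x"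
      using d by (simp add: real_sqrt_divide)
    have "(S' / d x - \<gamma> x / d x) / (V / (d x)\<^sup>2) * (Z / d x) = (S' - \<gamma> x) / V * Z" for S' V Z
      using d by (cases "V = 0") (simp_all add: field_simps power2_eq_square)
    then show ?thesis
      unfolding S vz unfolding vv rank1_gain_def by simp
  qed
  moreover have "((\<lambda>x. (sqrt ((\<gamma> x / d x)\<^sup>2 + (1 - (\<gamma> x)\<^sup>2) * (?v x \<bullet> ?v x)) - \<gamma> x / d x) / (?v x \<bullet> ?v x) * (?v x \<bullet> z))
      \<longlongrightarrow> (sqrt (0\<^sup>2 + (1 - 0\<^sup>2) * (w \<bullet> w)) - 0) / (w \<bullet> w) * (w \<bullet> z)) F"
    using w by (intro tendsto_intros v \<gamma>) simp
  moreover have "(sqrt (0\<^sup>2 + (1 - 0\<^sup>2) * (w \<bullet> w)) - 0) / (w \<bullet> w) * (w \<bullet> z) = (w \<bullet> z) / norm w"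
    using w by (simp add: norm_eq_sqrt_inner[symmetric] power2_norm_eq_inner[symmetric] power2_eq_square)
  ultimately show ?thesis
    by simp
qed

lemma Maclaurin_cos_bound: "\<bar>cos x - (\<Sum>m<n. cos_coeff m * x ^ m)\<bar> \<le> \<bar>x\<bar> ^ n"
proof -
  obtain t where t: "cos x = (\<Sum>m<n. cos_coeff m * x ^ m) + (cos (t + 1/2 * real n * pi) / fact n) * x ^ n"
    using Maclaurin_cos_expansion[of x n] by blast
  have "\<bar>cos (t + 1/2 * real n * pi) / fact n\<bar> \<le> 1"
    using fact_ge_1[of n, where 'a = real] by (simp add: abs_divide divide_le_eq order_trans[OF abs_cos_le_one])
  then have "\<bar>(cos (t + 1/2 * real n * pi) / fact n) * x ^ n\<bar> \<le> 1 * \<bar>x\<bar> ^ n"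
    unfolding abs_mult power_abs by (rule mult_right_mono) simp
  then show ?thesis
    by (simp add: t)
qed

lemma Maclaurin_sin_bound': "\<bar>sin x - (\<Sum>m<n. sin_coeff m * x ^ m)\<bar> \<le> \<bar>x\<bar> ^ n"
proof -
  have "inverse (fact n) * \<bar>x\<bar> ^ n \<le> 1 * \<bar>x\<bar> ^ n"
    using fact_ge_1[of n, where 'a = real] by (intro mult_right_mono inverse_le_1_iff[THEN iffD2]) auto
  with Maclaurin_sin_bound[of x n] show ?thesis by simp
qed

definition centered_monomial :: "nat \<Rightarrow> real^'n::{finite,linorder}" where
  "centered_monomial m = (\<chi> t. centered t ^ m)"

definition trend_remainder :: "nat \<Rightarrow> real \<Rightarrow> real \<Rightarrow> real \<Rightarrow> real^'n::{finite,linorder}" where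
  "trend_remainder p \<nu> a b = a *\<^sub>R cos_vec \<nu> + b *\<^sub>R sin_vec \<nu>
     - (\<Sum>m\<le>p. ((a * cos_coeff m + b * sin_coeff m) * \<nu> ^ m) *\<^sub>R centered_monomial m)"

lemma abs_trend_remainder_le:
  assumes "0 \<le> \<nu>" "\<bar>a\<bar> \<le> B" "\<bar>b\<bar> \<le> B"
  shows "\<bar>trend_remainder p \<nu> a b $ t\<bar> \<le> 2 * B * \<nu> ^ Suc p * \<bar>centered t\<bar> ^ Suc p"
proof -
  let ?x = "\<nu> * centered t"
  let ?C = "cos ?x - (\<Sum>m<Suc p. cos_coeff m * ?x ^ m)" and ?S = "sin ?x - (\<Sum>m<Suc p. sin_coeff m * ?x ^ m)"
  have "(\<Sum>m\<le>p. (a * cos_coeff m + b * sin_coeff m) * \<nu> ^ m * centered t ^ m) =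
      (\<Sum>m<Suc p. a * (cos_coeff m * ?x ^ m) + b * (sin_coeff m * ?x ^ m))"
    by (rule sum.cong) (auto simp: power_mult_distrib algebra_simps)
  also have "\<dots> = a * (\<Sum>m<Suc p. cos_coeff m * ?x ^ m) + b * (\<Sum>m<Suc p. sin_coeff m * ?x ^ m)"
    by (simp only: sum.distrib sum_distrib_left)
  finally have "trend_remainder p \<nu> a b $ t = a * ?C + b * ?S"
    unfolding right_diff_distrib by (simp add: trend_remainder_def cos_vec_def sin_vec_def centered_monomial_def)
  also have "\<bar>\<dots>\<bar> \<le> \<bar>a\<bar> * \<bar>?C\<bar> + \<bar>b\<bar> * \<bar>?S\<bar>"
    using abs_triangle_ineq[of "a * ?C" "b * ?S"] by (simp only: abs_mult)
  also have "\<dots> \<le> B * \<bar>?x\<bar> ^ Suc p + B * \<bar>?x\<bar> ^ Suc p"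
    using assms by (intro add_mono mult_mono Maclaurin_cos_bound Maclaurin_sin_bound') auto
  finally show ?thesis
    using assms(1) by (simp add: abs_mult power_mult_distrib mult_ac)
qed

text \<open>Along \<open>\<nu> = x\<^sup>2\<close>, \<open>\<gamma> = x ^ (2 * p + 1)\<close> the noise dominates the Taylor remainder, of order
  \<open>x ^ (2 * p + 2)\<close>, and is dominated by the monomial of degree \<open>p\<close>, of order \<open>x ^ (2 * p)\<close>.\<close>

lemma trend_root_decomposition:
  fixes z :: "real^'n::{finite,linorder}" and p :: nat
  assumes x: "0 < x"
  defines "\<nu> \<equiv> x\<^sup>2" and "\<gamma> \<equiv> x ^ (2 * p + 1)"
  defines "a \<equiv> rank1_gain \<gamma> (cos_vec \<nu> :: real^'n::{finite,linorder}) * (cos_vec \<nu> \<bullet> z)"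
    and "b \<equiv> rank1_gain \<gamma> (sin_vec \<nu> :: real^'n::{finite,linorder}) * (sin_vec \<nu> \<bullet> z)"
  shows "trend_root \<nu> \<gamma> *v z = \<gamma> *\<^sub>R (z + (1 / \<gamma>) *\<^sub>R trend_remainder p \<nu> a b
    + (\<Sum>m<p. ((a * cos_coeff m + b * sin_coeff m) * \<nu> ^ m / \<gamma>) *\<^sub>R centered_monomial m)
    + ((a * cos_coeff p + b * sin_coeff p) / x) *\<^sub>R centered_monomial p)"
proof -
  have \<gamma>: "0 < \<gamma>"
    using x by (simp add: \<gamma>_def)
  \<comment> \<open>This 1 / x is the rate at which the leading trend outgrows the noise.\<close>
  have xp: "\<nu> ^ p / \<gamma> = 1 / x"
    using x by (simp add: \<nu>_def \<gamma>_def power_mult)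
  let ?c = "\<lambda>m. a * cos_coeff m + b * sin_coeff m"
  have "a *\<^sub>R cos_vec \<nu> + b *\<^sub>R sin_vec \<nu> = trend_remainder p \<nu> a b + (\<Sum>m<p. (?c m * \<nu> ^ m) *\<^sub>R centered_monomial m)
      + (?c p * \<nu> ^ p) *\<^sub>R centered_monomial p"
    by (simp add: trend_remainder_def lessThan_Suc_atMost[symmetric])
  also have "\<dots> = \<gamma> *\<^sub>R ((1 / \<gamma>) *\<^sub>R trend_remainder p \<nu> a b
      + (\<Sum>m<p. (?c m * \<nu> ^ m / \<gamma>) *\<^sub>R centered_monomial m) + (?c p * (\<nu> ^ p / \<gamma>)) *\<^sub>R centered_monomial p)"
    using \<gamma> by (simp add: scaleR_right_distrib scaleR_sum_right)
  finally show ?thesis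
    unfolding trend_root_mult xp a_def[symmetric] b_def[symmetric] by (simp add: scaleR_right_distrib add_ac)
qed

lemma tendsto_trend_remainder:
  fixes z :: "real^'n::{finite,linorder}"
  assumes x: "\<And>k. 0 < x k" "x \<longlonglongrightarrow> 0" and ab: "\<And>k. \<bar>a k\<bar> \<le> B" "\<And>k. \<bar>b k\<bar> \<le> B"
  shows "(\<lambda>k. (1 / x k ^ (2 * p + 1)) *\<^sub>R trend_remainder p ((x k)\<^sup>2) (a k) (b k) :: real^'n::{finite,linorder}) \<longlonglongrightarrow> 0"
proof (rule vec_tendstoI)
  fix t :: 'n
  let ?r = "\<lambda>k. (1 / x k ^ (2 * p + 1)) *\<^sub>R trend_remainder p ((x k)\<^sup>2) (a k) (b k) :: real^'n::{finite,linorder}"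
  have le: "norm (?r k $ t) \<le> 2 * B * x k * \<bar>centered t\<bar> ^ Suc p" for k
  proof -
    have "norm (?r k $ t) = 1 / x k ^ (2 * p + 1) * \<bar>trend_remainder p ((x k)\<^sup>2) (a k) (b k) $ t\<bar>"
      using x(1)[of k] by (simp add: abs_mult)
    also have "\<dots> \<le> 1 / x k ^ (2 * p + 1) * (2 * B * ((x k)\<^sup>2) ^ Suc p * \<bar>centered t\<bar> ^ Suc p)"
      using x(1)[of k] ab by (intro mult_left_mono abs_trend_remainder_le) auto
    also have "((x k)\<^sup>2) ^ Suc p = x k ^ Suc (2 * p + 1)"
      by (subst power_mult[symmetric]) (rule arg_cong[of _ _ "power (x k)"], simp)
    also have "\<dots> = x k ^ (2 * p + 1) * x k"
      by (rule power_Suc2)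
    finally show ?thesis
      using x(1)[of k] by simp
  qed
  have "(\<lambda>k. 2 * B * x k * \<bar>centered t\<bar> ^ Suc p) \<longlonglongrightarrow> 2 * B * 0 * \<bar>centered t\<bar> ^ Suc p"
    by (intro tendsto_intros x)
  then have "(\<lambda>k. 2 * B * x k * \<bar>centered t\<bar> ^ Suc p) \<longlonglongrightarrow> 0"
    by simp
  with le have "(\<lambda>k. ?r k $ t) \<longlonglongrightarrow> 0"
    by (rule Lim_null_comparison[OF always_eventually[OF allI]])
  then show "(\<lambda>k. ?r k $ t) \<longlonglongrightarrow> 0 $ t"
    by simp
qed

text \<open>By parity exactly one of \<open>cos_coeff p\<close> and \<open>sin_coeff p\<close> is
  nonzero. The trend coefficient that it multiplies tends to the component of \<open>z\<close> along
  the normalized constant vector or the normalized centered linear trend, which the assumptions on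
  \<open>z\<close> keep away from zero.\<close>

lemma leading_coefficient_tendsto:
  fixes z :: "real^'n::{finite,linorder}" and p :: nat
  assumes x: "\<And>k. 0 < x k" "x \<longlonglongrightarrow> 0"
    and z: "centered_monomial 0 \<bullet> z \<noteq> 0" "centered_monomial 1 \<bullet> z \<noteq> 0"
  defines "a \<equiv> \<lambda>k. rank1_gain (x k ^ (2 * p + 1)) (cos_vec ((x k)\<^sup>2) :: real^'n::{finite,linorder}) * (cos_vec ((x k)\<^sup>2) \<bullet> z)"
    and "b \<equiv> \<lambda>k. rank1_gain (x k ^ (2 * p + 1)) (sin_vec ((x k)\<^sup>2) :: real^'n::{finite,linorder}) * (sin_vec ((x k)\<^sup>2) \<bullet> z)"
  shows "\<exists>c. c \<noteq> 0 \<and> (\<lambda>k. a k * cos_coeff p + b k * sin_coeff p) \<longlonglongrightarrow> c"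
proof -
  have x2: "(\<lambda>k. (x k)\<^sup>2) \<longlonglongrightarrow> 0"
    using tendsto_power[OF x(2), of 2] by simp
  have \<gamma>: "(\<lambda>k. x k ^ (2 * p + 1)) \<longlonglongrightarrow> 0"
    using tendsto_power[OF x(2), of "2 * p + 1"] by simp
  show ?thesis
  proof (cases "even p")
    case True
    \<comment> \<open>The cosine vector has a nonzero limit, so the normalization is d = 1.\<close>
    have "(\<lambda>k. cos_vec ((x k)\<^sup>2) /\<^sub>R 1) \<longlonglongrightarrow> (centered_monomial 0 :: real^'n::{finite,linorder})"
    proof (rule vec_tendstoI)
      fix t :: 'n
      have "(\<lambda>k. cos ((x k)\<^sup>2 * centered t)) \<longlonglongrightarrow> cos (0 * centered t)"
        by (intro tendsto_intros x2)
      then show "(\<lambda>k. (cos_vec ((x k)\<^sup>2) /\<^sub>R 1) $ t) \<longlonglongrightarrow> centered_monomial 0 $ t"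
        by (simp add: cos_vec_def centered_monomial_def)
    qed
    then have "a \<longlonglongrightarrow> (centered_monomial 0 \<bullet> z) / norm (centered_monomial 0 :: real^'n::{finite,linorder})"
      unfolding a_def by (rule tendsto_rank1_gain) (use z \<gamma> in auto)
    then have "(\<lambda>k. a k * cos_coeff p) \<longlonglongrightarrow>
        (centered_monomial 0 \<bullet> z) / norm (centered_monomial 0 :: real^'n::{finite,linorder}) * cos_coeff p"
      by (rule tendsto_mult_right)
    then have "(\<lambda>k. a k * cos_coeff p + b k * sin_coeff p) \<longlonglongrightarrow>
        (centered_monomial 0 \<bullet> z) / norm (centered_monomial 0 :: real^'n::{finite,linorder}) * cos_coeff p"
      using True by (simp add: sin_coeff_def)
    moreover have "(centered_monomial 0 \<bullet> z) / norm (centered_monomial 0 :: real^'n::{finite,linorder}) * cos_coeff p \<noteq> 0"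
      using True z by (auto simp: cos_coeff_def)
    ultimately show ?thesis by blast
  next
    case False
    then have p: "p \<ge> 1"
      by (cases p) auto
    have x2': "filterlim (\<lambda>k. (x k)\<^sup>2) (at 0) sequentially"
      using x2 x(1) by (auto simp: filterlim_at less_imp_neq[THEN not_sym])
    \<comment> \<open>The sine vector shrinks like \<nu> = x^2, which is therefore the
      normalization; the limit is its derivative at zero.\<close>
    have "(\<lambda>k. sin_vec ((x k)\<^sup>2) /\<^sub>R (x k)\<^sup>2) \<longlonglongrightarrow> (centered_monomial 1 :: real^'n::{finite,linorder})"
    proof (rule vec_tendstoI)
      fix t :: 'n
      have "((\<lambda>h. sin (h * centered t)) has_real_derivative centered t) (at 0)"
        by (auto intro!: derivative_eq_intros)
      then have "((\<lambda>h. sin (h * centered t) / h) \<longlongrightarrow> centered t) (at 0)"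
        by (simp add: DERIV_def)
      then have "(\<lambda>k. sin ((x k)\<^sup>2 * centered t) / (x k)\<^sup>2) \<longlonglongrightarrow> centered t"
        using x2' by (rule filterlim_compose)
      then show "(\<lambda>k. (sin_vec ((x k)\<^sup>2) /\<^sub>R (x k)\<^sup>2) $ t) \<longlonglongrightarrow> centered_monomial 1 $ t"
        by (simp add: sin_vec_def centered_monomial_def divide_inverse mult.commute)
    qed
    \<comment> \<open>Relative to d = x^2 the noise is x^(2p - 1), which vanishes because an odd
      \<open>p\<close> is at least one.\<close>
    moreover have "(\<lambda>k. x k ^ (2 * p + 1) / (x k)\<^sup>2) \<longlonglongrightarrow> 0"
    proof -
      have eq: "x k ^ (2 * p + 1) / (x k)\<^sup>2 = x k ^ (2 * p - 1)" for k
        using x(1)[of k] p power_add[of "x k" "2 * p - 1" 2] by simp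
      show ?thesis
        unfolding eq using tendsto_power[OF x(2), of "2 * p - 1"] p by (simp add: power_0_left)
    qed
    ultimately have "b \<longlonglongrightarrow> (centered_monomial 1 \<bullet> z) / norm (centered_monomial 1 :: real^'n::{finite,linorder})"
      unfolding b_def by (intro tendsto_rank1_gain \<gamma>) (use z less_imp_neq[OF x(1), THEN not_sym] in auto)
    then have "(\<lambda>k. b k * sin_coeff p) \<longlonglongrightarrow>
        (centered_monomial 1 \<bullet> z) / norm (centered_monomial 1 :: real^'n::{finite,linorder}) * sin_coeff p"
      by (rule tendsto_mult_right)
    then have "(\<lambda>k. a k * cos_coeff p + b k * sin_coeff p) \<longlonglongrightarrow>
        (centered_monomial 1 \<bullet> z) / norm (centered_monomial 1 :: real^'n::{finite,linorder}) * sin_coeff p"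
      using False by (simp add: cos_coeff_def)
    moreover have "(centered_monomial 1 \<bullet> z) / norm (centered_monomial 1 :: real^'n::{finite,linorder}) * sin_coeff p \<noteq> 0"
      using False z by (auto simp: sin_coeff_def)
    ultimately show ?thesis by blast
  qed
qed

section \<open>Concentrating AR(2) spectral densities\<close>

lemma set_integrable_bounded_scaleR:
  fixes g :: "real \<Rightarrow> 'a::{banach,second_countable_topology}"
  assumes f: "set_integrable lebesgue {-pi..pi} f" and g: "continuous_on UNIV g" and B: "\<And>\<omega>. norm (g \<omega>) \<le> B"
  shows "set_integrable lebesgue {-pi..pi} (\<lambda>\<omega>. (f \<omega> :: real) *\<^sub>R g \<omega>)"
  unfolding set_integrable_def
proof (rule Bochner_Integration.integrable_bound)
  have m: "g \<in> borel_measurable lebesgue"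
    using borel_measurable_continuous_onI[OF g] by (intro measurable_completion) simp
  show "integrable lebesgue (\<lambda>\<omega>. B *\<^sub>R (indicat_real {-pi..pi} \<omega> *\<^sub>R f \<omega>))"
    using f unfolding set_integrable_def by (rule integrable_scaleR_right)
  show "(\<lambda>\<omega>. indicat_real {-pi..pi} \<omega> *\<^sub>R f \<omega> *\<^sub>R g \<omega>) \<in> borel_measurable lebesgue"
    using borel_measurable_scaleR[OF borel_measurable_integrable[OF f[unfolded set_integrable_def]] m] by simp
  show "AE \<omega> in lebesgue. norm (indicat_real {-pi..pi} \<omega> *\<^sub>R f \<omega> *\<^sub>R g \<omega>) \<le> norm (B *\<^sub>R (indicat_real {-pi..pi} \<omega> *\<^sub>R f \<omega>))"
    using order_trans[OF B abs_ge_self]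
    by (intro AE_I2) (auto simp: abs_mult indicator_def mult.commute[of "\<bar>f _\<bar>"] intro!: mult_right_mono)
qed

lemma cov_matrix_eq:
  assumes f: "set_integrable lebesgue {-pi..pi} f"
  shows "cov_matrix f $ j $ l = (LINT \<omega>:{-pi..pi}|lebesgue. f \<omega> * cos ((real (idx j) - real (idx l)) * \<omega>))"
proof -
  let ?d = "real (idx j) - real (idx l)"
  have eq: "exp (- (\<i> * of_int (int (idx j) - int (idx l)) * of_real \<omega>)) * of_real (f \<omega>) = f \<omega> *\<^sub>R cis (- (?d * \<omega>))" for \<omega>
    by (simp add: cis_conv_exp scaleR_conv_of_real mult_ac)
  have int: "set_integrable lebesgue {-pi..pi} (\<lambda>\<omega>. f \<omega> *\<^sub>R cis (- (?d * \<omega>)))"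
    by (rule set_integrable_bounded_scaleR[OF f]) (auto intro!: continuous_intros)
  show ?thesis
  proof -
    have "cov_matrix f $ j $ l = Re (LINT \<omega>:{-pi..pi}|lebesgue.
        exp (- (\<i> * of_int (int (idx j) - int (idx l)) * of_real \<omega>)) * of_real (f \<omega>))"
      by (simp add: cov_matrix_def)
    also have "\<dots> = (LINT \<omega>:{-pi..pi}|lebesgue. f \<omega> * cos (?d * \<omega>))"
      unfolding eq using integral_Re[OF int[unfolded set_integrable_def]]
      by (simp add: set_lebesgue_integral_def mult.assoc)
    finally show ?thesis .
  qed
qed

text \<open>The form is the integral of f times the squared modulus of the trigonometric sum with
  coefficients \<open>v\<close>, here separated into a cosine and a sine sum.\<close>

lemma nonneg_definite_cov_matrix:
  assumes f: "set_integrable lebesgue {-pi..pi} f" and nn: "\<And>\<omega>. \<omega> \<in> {-pi..pi} \<Longrightarrow> 0 \<le> f \<omega>"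
  shows "nonneg_definite (cov_matrix f :: real^'n::{finite,linorder}^'n::{finite,linorder})"
proof -
  let ?h = "\<lambda>\<omega>. indicat_real {-pi..pi} \<omega> * f \<omega>"
  have cov: "cov_matrix f $ j $ l = (\<integral>\<omega>. ?h \<omega> * cos ((real (idx j) - real (idx l)) * \<omega>) \<partial>lebesgue)" for j l :: 'n
    unfolding cov_matrix_eq[OF f] by (simp add: set_lebesgue_integral_def mult.assoc)
  have int: "integrable lebesgue (\<lambda>\<omega>. ?h \<omega> * cos ((real (idx j) - real (idx l)) * \<omega>))" for j l :: 'n
    using set_integrable_bounded_scaleR[OF f, of "\<lambda>\<omega>. cos ((real (idx j) - real (idx l)) * \<omega>)" 1]
    by (simp add: set_integrable_def mult.assoc continuous_intros)
  have "transpose (cov_matrix f) = (cov_matrix f :: real^'n::_^'n::_)"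
  proof -
    have "cos ((real (idx j) - real (idx l)) * \<omega>) = cos ((real (idx l) - real (idx j)) * \<omega>)" for j l :: 'n and \<omega>
      using cos_minus[of "(real (idx j) - real (idx l)) * \<omega>"] by (simp add: algebra_simps)
    then show ?thesis
      by (simp add: vec_eq_iff transpose_def cov)
  qed
  moreover have "0 \<le> v \<bullet> (cov_matrix f *v v)" for v :: "real^'n::_"
  proof -
    have "v \<bullet> (cov_matrix f *v v) = (\<Sum>j\<in>UNIV. \<Sum>l\<in>UNIV. v $ j * v $ l * cov_matrix f $ j $ l)"
      by (simp add: inner_vec_def matrix_vector_mult_def sum_distrib_left mult_ac)
    also have "\<dots> = (\<Sum>j\<in>UNIV. \<Sum>l\<in>UNIV. \<integral>\<omega>. v $ j * v $ l * (?h \<omega> * cos ((real (idx j) - real (idx l)) * \<omega>)) \<partial>lebesgue)"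
      by (simp only: cov integral_mult_right_zero)
    also have "\<dots> = (\<integral>\<omega>. (\<Sum>j\<in>UNIV. \<Sum>l\<in>UNIV. v $ j * v $ l * (?h \<omega> * cos ((real (idx j) - real (idx l)) * \<omega>))) \<partial>lebesgue)"
      by (simp add: int Bochner_Integration.integral_sum integrable_mult_right Bochner_Integration.integrable_sum)
    also have "0 \<le> \<dots>"
    proof (rule integral_nonneg_AE, rule AE_I2)
      fix \<omega>
      let ?c = "\<lambda>j. v $ j * cos (real (idx j) * \<omega>)" and ?s = "\<lambda>j. v $ j * sin (real (idx j) * \<omega>)"
      have "(\<Sum>j\<in>UNIV. \<Sum>l\<in>UNIV. v $ j * v $ l * (?h \<omega> * cos ((real (idx j) - real (idx l)) * \<omega>))) =
          ?h \<omega> * (\<Sum>j\<in>UNIV. \<Sum>l\<in>UNIV. ?c j * ?c l + ?s j * ?s l)"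
        unfolding sum_distrib_left by (intro sum.cong refl) (simp add: left_diff_distrib cos_diff algebra_simps)
      also have "(\<Sum>j\<in>UNIV. \<Sum>l\<in>UNIV. ?c j * ?c l + ?s j * ?s l) = (\<Sum>j\<in>UNIV. ?c j)\<^sup>2 + (\<Sum>j\<in>UNIV. ?s j)\<^sup>2"
        by (simp only: sum.distrib power2_eq_square sum_product)
      finally show "0 \<le> (\<Sum>j\<in>UNIV. \<Sum>l\<in>UNIV. v $ j * v $ l * (?h \<omega> * cos ((real (idx j) - real (idx l)) * \<omega>)))"
        using nn[of \<omega>] by (simp add: indicator_def)
    qed
    finally show ?thesis .
  qed
  ultimately show ?thesis
    by (simp add: nonneg_definite_def)
qed

lemma inj_idx: "idx i = idx j \<longleftrightarrow> i = (j :: 'a::{finite,linorder})"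
  using bij_betw_idx[where 'a = 'a] by (auto simp: bij_betw_def inj_on_def)

lemma set_integral_cos_multiple:
  fixes d :: int
  shows "(LINT \<omega>:{-pi..pi}|lebesgue. cos (of_int d * \<omega>)) = (if d = 0 then 2 * pi else 0)"
proof -
  have "(LINT \<omega>:{-pi..pi}|lebesgue. cos (of_int d * \<omega>)) = integral {-pi..pi} (\<lambda>\<omega>. cos (of_int d * \<omega>))"
    by (intro set_lebesgue_integral_eq_integral absolutely_integrable_continuous_real continuous_intros)
  also have "\<dots> = (if d = 0 then 2 * pi else 0)"
  proof (cases "d = 0")
    case False
    have "((\<lambda>\<omega>. cos (of_int d * \<omega>)) has_integral (sin (of_int d * pi) / of_int d - sin (of_int d * - pi) / of_int d)) {-pi..pi}"
      using False by (intro fundamental_theorem_of_calculus)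
        (auto intro!: derivative_eq_intros simp: has_real_derivative_iff_has_vector_derivative[symmetric])
    moreover have "sin (of_int d * pi) = 0"
      using sin_zero_iff_int2 by blast
    ultimately show ?thesis
      using False by (auto dest: integral_unique)
  qed (simp)
  finally show ?thesis .
qed

text \<open>Orthogonality of the cosines turns the constant density 1 / (2 pi) into the identity
  matrix, so \<open>c2\<close> is the variance of added white noise.\<close>

lemma cov_matrix_mixture:
  assumes f: "set_integrable lebesgue {-pi..pi} f"
  shows "cov_matrix (\<lambda>\<omega>\<in>{-pi..pi}. c1 * f \<omega> + c2 / (2 * pi)) = c1 *\<^sub>R cov_matrix f + c2 *\<^sub>R mat 1"
proof -
  let ?g = "\<lambda>\<omega>\<in>{-pi..pi}. c1 * f \<omega> + c2 / (2 * pi)"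
  have int_f: "set_integrable lebesgue {-pi..pi} (\<lambda>\<omega>. f \<omega> * cos (d * \<omega>))" for d
    using set_integrable_bounded_scaleR[OF f, of "\<lambda>\<omega>. cos (d * \<omega>)" 1] by (simp add: continuous_intros)
  have int_c: "set_integrable lebesgue {-pi..pi} (\<lambda>\<omega>. cos (d * \<omega>))" for d
    by (intro absolutely_integrable_continuous_real continuous_intros)
  have "set_integrable lebesgue {-pi..pi} (\<lambda>\<omega>. c1 * f \<omega> + c2 / (2 * pi))"
    by (intro set_integral_add set_integrable_mult_right f absolutely_integrable_continuous_real continuous_intros)
  then have g: "set_integrable lebesgue {-pi..pi} ?g"
    unfolding set_integrable_def by (rule back_subst[of "integrable lebesgue"]) (auto simp: indicator_def)
  have "cov_matrix ?g $ j $ l = c1 * cov_matrix f $ j $ l + c2 * of_bool (j = l)" for j l :: 'a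
  proof -
    let ?d = "real (idx j) - real (idx l)"
    have "cov_matrix ?g $ j $ l = (LINT \<omega>:{-pi..pi}|lebesgue. c1 * (f \<omega> * cos (?d * \<omega>)) + c2 / (2 * pi) * cos (?d * \<omega>))"
      unfolding cov_matrix_eq[OF g] by (rule set_lebesgue_integral_cong) (auto simp: algebra_simps)
    also have "\<dots> = c1 * (LINT \<omega>:{-pi..pi}|lebesgue. f \<omega> * cos (?d * \<omega>)) + c2 / (2 * pi) * (LINT \<omega>:{-pi..pi}|lebesgue. cos (?d * \<omega>))"
      by (subst set_integral_add) (simp_all only: set_integrable_mult_right int_f int_c set_integral_mult_right)
    also have "(LINT \<omega>:{-pi..pi}|lebesgue. cos (?d * \<omega>)) = 2 * pi * of_bool (j = l)"
      using set_integral_cos_multiple[of "int (idx j) - int (idx l)"] by (auto simp: inj_idx)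
    finally show ?thesis
      by (simp only: cov_matrix_eq[OF f]) simp
  qed
  then show ?thesis
    by (simp add: vec_eq_iff mat_def of_bool_def)
qed

section \<open>Spectral mass near a single pair of frequencies\<close>

text \<open>cos (k x) is a Chebyshev polynomial in cos x, hence Lipschitz in cos x; the constant
  comes from the three-term recurrence. This reduces the convergence of all autocovariances to one
  integral of |cos \<omega> - cos \<nu>|.\<close>

lemma cos_multiple_Lipschitz:
  "\<exists>K\<ge>0. \<forall>x y. \<bar>cos (real k * x) - cos (real k * y)\<bar> \<le> K * \<bar>cos x - cos y\<bar>"
proof (induction k rule: induct_nat_012)
  case 0
  then show ?case by (intro exI[of _ 0]) simp
next
  case 1
  then show ?case by (intro exI[of _ 1]) simp
next
  case (ge2 k)
  then obtain K L where K: "0 \<le> K" "\<And>x y. \<bar>cos (real k * x) - cos (real k * y)\<bar> \<le> K * \<bar>cos x - cos y\<bar>"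
    and L: "0 \<le> L" "\<And>x y. \<bar>cos (real (Suc k) * x) - cos (real (Suc k) * y)\<bar> \<le> L * \<bar>cos x - cos y\<bar>"
    by blast
  have rec: "cos (real (Suc (Suc k)) * x) = 2 * cos x * cos (real (Suc k) * x) - cos (real k * x)" for x
    using cos_add[of "real (Suc k) * x" x] cos_diff[of "real (Suc k) * x" x] by (simp add: algebra_simps)
  have "\<bar>cos (real (Suc (Suc k)) * x) - cos (real (Suc (Suc k)) * y)\<bar> \<le> (2 * L + 2 + K) * \<bar>cos x - cos y\<bar>" for x y
  proof -
    let ?a = "cos (real (Suc k) * x) - cos (real (Suc k) * y)" and ?b = "cos (real k * x) - cos (real k * y)"
    have "cos (real (Suc (Suc k)) * x) - cos (real (Suc (Suc k)) * y) =
        2 * (cos x * ?a) + 2 * ((cos x - cos y) * cos (real (Suc k) * y)) - ?b"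
      unfolding rec by (simp add: algebra_simps)
    also have "\<bar>\<dots>\<bar> \<le> 2 * \<bar>cos x * ?a\<bar> + 2 * \<bar>(cos x - cos y) * cos (real (Suc k) * y)\<bar> + \<bar>?b\<bar>"
      by linarith
    also have "\<dots> \<le> 2 * \<bar>?a\<bar> + 2 * \<bar>cos x - cos y\<bar> + \<bar>?b\<bar>"
      unfolding abs_mult by (intro add_mono mult_left_mono mult_left_le_one_le mult_right_le_one_le) auto
    also have "\<dots> \<le> 2 * (L * \<bar>cos x - cos y\<bar>) + 2 * \<bar>cos x - cos y\<bar> + K * \<bar>cos x - cos y\<bar>"
      by (intro add_mono mult_left_mono K L) auto
    finally show ?thesis
      by (simp add: algebra_simps)
  qed
  with K(1) L(1) show ?case
    by (intro exI[of _ "2 * L + 2 + K"]) auto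
qed

text \<open>For \<open>b \<rightarrow> 1\<close> the reciprocal of this transfer function concentrates at \<open>\<omega> = \<plusminus>\<nu>\<close>.\<close>

lemma AR2_transfer_function:
  "(cmod (1 - of_real ((1 + b) * cos \<nu>) * cis (- \<omega>) - of_real (- b) * cis (- 2 * \<omega>)))\<^sup>2 =
    (1 + b)\<^sup>2 * (cos \<omega> - cos \<nu>)\<^sup>2 + (1 - b)\<^sup>2 * (sin \<omega>)\<^sup>2" (is "(cmod ?A)\<^sup>2 = _")
proof -
  have alg: "c * (1 - x * d - - y * e) = c - x * (c * d) + y * (c * e)" for c d e x y :: complex
    by (simp add: algebra_simps)
  \<comment> \<open>The factor cis \<omega> of modulus one symmetrizes the polynomial, so that 1 + b
    occurs only in the real part and 1 - b only in the imaginary part. The coefficient (1 + b) cos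
    \<nu> makes the real part vanish exactly where cos \<omega> = cos \<nu>.\<close>
  have "(cmod ?A)\<^sup>2 = (cmod (cis \<omega> * ?A))\<^sup>2"
    by (simp add: norm_mult)
  also have "cis \<omega> * ?A = cis \<omega> - of_real ((1 + b) * cos \<nu>) * (cis \<omega> * cis (- \<omega>)) + of_real b * (cis \<omega> * cis (- 2 * \<omega>))"
    unfolding of_real_minus by (rule alg)
  also have "\<dots> = cis \<omega> - of_real ((1 + b) * cos \<nu>) + of_real b * cis (- \<omega>)"
    by (simp add: cis_mult)
  also have "\<dots> = Complex ((1 + b) * (cos \<omega> - cos \<nu>)) ((1 - b) * sin \<omega>)"
    by (simp add: complex_eq_iff algebra_simps)
  finally show ?thesis
    by (simp add: cmod_power2 power_mult_distrib)
qed

lemma abs_cos_diff_le: "\<bar>cos x - cos y\<bar> \<le> \<bar>x - y :: real\<bar>"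
proof -
  have "\<bar>cos x - cos y\<bar> = 2 * \<bar>sin ((x + y) / 2)\<bar> * \<bar>sin ((y - x) / 2)\<bar>"
    by (simp add: cos_diff_cos abs_mult)
  also have "\<dots> \<le> 2 * 1 * \<bar>(y - x) / 2\<bar>"
    by (intro mult_mono abs_sin_x_le_abs_x) auto
  finally show ?thesis by simp
qed

lemma abs_cos_diff_le_2: "\<bar>cos x - cos y\<bar> \<le> (2 :: real)"
  using cos_le_one[of x] cos_le_one[of y] cos_ge_minus_one[of x] cos_ge_minus_one[of y] by linarith

text \<open>With \<delta> = 1 - b, \<open>D\<close> is of order \<delta>^2 on an interval of length
  \<delta> ending at \<nu>, so the integral \<open>I\<close> of its reciprocal is at least of order
  1 / \<delta>. Everywhere (cos \<omega> - cos \<nu>)^2 \<le> D, so the normalized density times the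
  squared distance is at most 1 / I, of order \<delta>.\<close>

lemma exists_AR2_concentrated:
  assumes \<nu>: "0 < \<nu>" "\<nu> < pi" and \<eta>: "0 < \<eta>"
  shows "\<exists>f\<in>spectral_densities_AR2. (LINT \<omega>:{-pi..pi}|lebesgue. f \<omega> * \<bar>cos \<omega> - cos \<nu>\<bar>) \<le> \<eta>"
proof -
  \<comment> \<open>The bound 1 / 2 gives b > 0, \<nu> / 2 keeps [\<nu> - \<delta>, \<nu>] inside
    [-pi, pi], and 17 exceeds 5 pi + 1 / 2, the factor of sqrt \<delta> in the final
    estimate.\<close>
  define \<delta> where "\<delta> = min (1 / 2) (min (\<nu> / 2) ((\<eta> / 17)\<^sup>2))"
  have \<delta>: "0 < \<delta>" "\<delta> < 1" "\<delta> < \<nu>" and "\<delta> \<le> (\<eta> / 17)\<^sup>2"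
    using \<nu> \<eta> by (auto simp: \<delta>_def min_def)
  then have \<eta>\<delta>: "17 * sqrt \<delta> \<le> \<eta>"
    using real_sqrt_le_mono[of \<delta> "(\<eta> / 17)\<^sup>2"] \<eta> by simp
  define b where "b = 1 - \<delta>"
  define D where "D \<omega> = (1 + b)\<^sup>2 * (cos \<omega> - cos \<nu>)\<^sup>2 + (1 - b)\<^sup>2 * (sin \<omega>)\<^sup>2" for \<omega>
  have b: "0 < b" "b < 1" "1 - b = \<delta>"
    using \<delta> by (auto simp: b_def)
  have cos\<nu>: "\<bar>cos \<nu>\<bar> < 1"
  proof -
    have "0 < (sin \<nu>)\<^sup>2"
      using \<nu> sin_gt_zero[of \<nu>] by simp
    then have "(cos \<nu>)\<^sup>2 < 1"
      using sin_cos_squared_add[of \<nu>] by linarith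
    then show ?thesis
      by (simp add: abs_square_less_1[symmetric])
  qed
  \<comment> \<open>Both squares vanish only if cos \<omega> = cos \<nu> and sin \<omega> = 0, which
    |cos \<nu>| < 1 excludes.\<close>
  have D_pos: "0 < D \<omega>" for \<omega>
  proof (rule ccontr)
    assume "\<not> 0 < D \<omega>"
    moreover have "0 \<le> (1 + b)\<^sup>2 * (cos \<omega> - cos \<nu>)\<^sup>2" "0 \<le> (1 - b)\<^sup>2 * (sin \<omega>)\<^sup>2"
      by simp_all
    ultimately have "(1 + b)\<^sup>2 * (cos \<omega> - cos \<nu>)\<^sup>2 = 0" "(1 - b)\<^sup>2 * (sin \<omega>)\<^sup>2 = 0"
      unfolding D_def by linarith+
    then have "cos \<omega> = cos \<nu>" "sin \<omega> = 0"
      using b by auto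
    then show False
      using cos\<nu> sin_cos_squared_add[of \<omega>] by (simp add: power2_eq_1_iff) fastforce
  qed
  have D_cont: "continuous_on S D" for S
    unfolding D_def by (intro continuous_intros)
  have invD_int: "set_integrable lebesgue {-pi..pi} (\<lambda>\<omega>. 1 / D \<omega>)"
    using D_pos by (intro absolutely_integrable_continuous_real continuous_intros D_cont) (metis less_irrefl)
  define I where "I = (LINT \<omega>:{-pi..pi}|lebesgue. 1 / D \<omega>)"
  have I: "1 / (5 * \<delta>) \<le> I"
  proof -
    have sub: "{\<nu> - \<delta>..\<nu>} \<subseteq> {-pi..pi}"
      using \<nu> \<delta> by auto
    have "1 / (5 * \<delta>) = (LINT \<omega>:{\<nu> - \<delta>..\<nu>}|lebesgue. 1 / (5 * \<delta>\<^sup>2))"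
      using \<delta> by (simp add: power2_eq_square set_lebesgue_integral_def)
    also have "\<dots> \<le> (LINT \<omega>:{\<nu> - \<delta>..\<nu>}|lebesgue. 1 / D \<omega>)"
    proof (rule set_integral_mono)
      show "set_integrable lebesgue {\<nu> - \<delta>..\<nu>} (\<lambda>\<omega>. 1 / (5 * \<delta>\<^sup>2))"
        by (intro absolutely_integrable_continuous_real continuous_intros)
      show "set_integrable lebesgue {\<nu> - \<delta>..\<nu>} (\<lambda>\<omega>. 1 / D \<omega>)"
        using D_pos by (intro absolutely_integrable_continuous_real continuous_intros D_cont) (metis less_irrefl)
      fix \<omega>
      assume \<omega>: "\<omega> \<in> {\<nu> - \<delta>..\<nu>}"
      have "(cos \<omega> - cos \<nu>)\<^sup>2 \<le> \<delta>\<^sup>2"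
        using abs_cos_diff_le[of \<omega> \<nu>] \<omega> by (intro abs_le_square_iff[THEN iffD1]) auto
      moreover have "(1 + b)\<^sup>2 \<le> 2\<^sup>2"
        using b by (intro power_mono) auto
      ultimately have "(1 + b)\<^sup>2 * (cos \<omega> - cos \<nu>)\<^sup>2 \<le> 2\<^sup>2 * \<delta>\<^sup>2"
        by (intro mult_mono) auto
      moreover have "\<delta>\<^sup>2 * (sin \<omega>)\<^sup>2 \<le> \<delta>\<^sup>2 * 1"
        by (intro mult_left_mono) (simp_all add: abs_square_le_1)
      \<comment> \<open>4 \<delta>^2 comes from 1 + b \<le> 2, the remaining \<delta>^2 from the
        sine term.\<close>
      ultimately have "D \<omega> \<le> 5 * \<delta>\<^sup>2"
        by (simp add: D_def b)
      then show "1 / (5 * \<delta>\<^sup>2) \<le> 1 / D \<omega>"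
        using D_pos \<delta> by (intro divide_left_mono mult_pos_pos) auto
    qed
    also have "\<dots> \<le> I"
      unfolding I_def set_lebesgue_integral_def
    proof (rule integral_mono)
      show "integrable lebesgue (\<lambda>\<omega>. indicat_real {\<nu> - \<delta>..\<nu>} \<omega> *\<^sub>R (1 / D \<omega>))"
        using set_integrable_subset[OF invD_int _ sub] by (simp add: set_integrable_def)
      show "integrable lebesgue (\<lambda>\<omega>. indicat_real {-pi..pi} \<omega> *\<^sub>R (1 / D \<omega>))"
        using invD_int by (simp add: set_integrable_def)
      show "indicat_real {\<nu> - \<delta>..\<nu>} \<omega> *\<^sub>R (1 / D \<omega>) \<le> indicat_real {-pi..pi} \<omega> *\<^sub>R (1 / D \<omega>)" for \<omega>
        using sub D_pos[of \<omega>] by (auto simp: indicator_def less_imp_le)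
    qed
    finally show ?thesis .
  qed
  have I_pos: "0 < I"
    using I \<delta> by (smt (verit) divide_pos_pos)
  define f where "f = (\<lambda>\<omega>\<in>{-pi..pi}. 1 / (I * D \<omega>))"
  have f_int: "set_integrable lebesgue {-pi..pi} f"
  proof -
    have "set_integrable lebesgue {-pi..pi} (\<lambda>\<omega>. 1 / I * (1 / D \<omega>))"
      by (intro set_integrable_mult_right invD_int)
    then show ?thesis
      unfolding set_integrable_def by (rule back_subst[of "integrable lebesgue"]) (auto simp: f_def indicator_def)
  qed
  have f_1: "(LINT \<omega>:{-pi..pi}|lebesgue. f \<omega>) = 1"
  proof -
    have "(LINT \<omega>:{-pi..pi}|lebesgue. f \<omega>) = (LINT \<omega>:{-pi..pi}|lebesgue. 1 / I * (1 / D \<omega>))"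
      by (rule set_lebesgue_integral_cong) (auto simp: f_def)
    also have "\<dots> = 1"
      unfolding set_integral_mult_right using I_pos by (simp add: I_def)
    finally show ?thesis .
  qed
  have f_nn: "0 \<le> f \<omega>" if "\<omega> \<in> {-pi..pi}" for \<omega>
    using that I_pos D_pos[of \<omega>] by (simp add: f_def)
  have f_sd: "f \<in> spectral_densities"
  proof -
    have "f \<in> extensional {-pi..pi}"
      by (simp add: f_def)
    moreover have "f (- \<omega>) = f \<omega>" if "\<omega> \<in> {-pi..pi}" for \<omega>
      using that by (simp add: f_def D_def)
    ultimately show ?thesis
      unfolding spectral_densities_def using f_int f_1 f_nn by blast
  qed
  \<comment> \<open>Positivity of \<open>D\<close> is the absence of zeros on the unit circle, as
    every point there is cis (- \<omega>) for some \<omega>.\<close>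
  have "1 - of_real ((1 + b) * cos \<nu>) * z - of_real (- b) * z\<^sup>2 \<noteq> 0" if "cmod z = 1" for z
  proof -
    define \<omega> where "\<omega> = - Arg z"
    have z: "z = cis (- \<omega>)"
      using rcis_cmod_Arg[of z] that by (simp add: rcis_def \<omega>_def)
    then have "z\<^sup>2 = cis (- 2 * \<omega>)"
      by (simp add: power2_eq_square cis_mult)
    with z show ?thesis
      using AR2_transfer_function[of b \<nu> \<omega>] D_pos[of \<omega>] unfolding D_def by auto
  qed
  moreover have "f \<omega> = (2 * pi / I) / (2 * pi) /
      (cmod (1 - of_real ((1 + b) * cos \<nu>) * cis (- \<omega>) - of_real (- b) * cis (- 2 * \<omega>)))\<^sup>2"
    if "\<omega> \<in> {-pi..pi}" for \<omega>
    unfolding AR2_transfer_function using that by (simp add: f_def D_def)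
  ultimately have f_AR2: "f \<in> spectral_densities_AR2"
    unfolding spectral_densities_AR2_def mem_Collect_eq using f_sd I_pos
    by (intro conjI exI[of _ "(1 + b) * cos \<nu>"] exI[of _ "- b"] exI[of _ "2 * pi / I"]) (auto simp del: of_real_mult)
  have f_cos: "f \<omega> * \<bar>cos \<omega> - cos \<nu>\<bar> \<le> 5 / 2 * sqrt \<delta> + sqrt \<delta> / 2 * f \<omega>" if "\<omega> \<in> {-pi..pi}" for \<omega>
  proof -
    let ?x = "\<bar>cos \<omega> - cos \<nu>\<bar>"
    have "1 * ?x\<^sup>2 \<le> (1 + b)\<^sup>2 * ?x\<^sup>2"
      using b by (intro mult_right_mono) auto
    also have "\<dots> \<le> D \<omega>"
      by (simp add: D_def)
    finally have "?x\<^sup>2 / (I * D \<omega>) \<le> D \<omega> / (I * D \<omega>)"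
      using I_pos D_pos[of \<omega>] by (intro divide_right_mono) auto
    also have "\<dots> = 1 / I"
      using D_pos[of \<omega>] by simp
    also have "\<dots> \<le> 5 * \<delta>"
      using I I_pos \<delta> by (simp add: field_simps)
    finally have 1: "f \<omega> * ?x\<^sup>2 \<le> 5 * \<delta>"
      using that by (simp add: f_def)
    \<comment> \<open>Comparing arithmetic and geometric means replaces the distance by its square,
      which the bound above controls, plus \<delta>, which only meets the total mass one of
      \<open>f\<close>.\<close>
    have "0 \<le> (?x - sqrt \<delta>)\<^sup>2"
      by simp
    then have "2 * sqrt \<delta> * ?x \<le> ?x\<^sup>2 + \<delta>"
      using \<delta> unfolding power2_diff by (simp add: mult_ac)
    then have "f \<omega> * (2 * sqrt \<delta> * ?x) \<le> f \<omega> * (?x\<^sup>2 + \<delta>)"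
      using f_nn[OF that] by (rule mult_left_mono)
    also have "\<dots> \<le> 5 * \<delta> + \<delta> * f \<omega>"
      using 1 by (simp add: algebra_simps)
    also have "\<dots> = 2 * sqrt \<delta> * (5 / 2 * sqrt \<delta> + sqrt \<delta> / 2 * f \<omega>)"
      using \<delta> by (simp add: algebra_simps)
    finally have "2 * sqrt \<delta> * (f \<omega> * ?x) \<le> 2 * sqrt \<delta> * (5 / 2 * sqrt \<delta> + sqrt \<delta> / 2 * f \<omega>)"
      by (simp only: mult_ac)
    then show ?thesis
      using \<delta> by (subst (asm) mult_le_cancel_left_pos) auto
  qed
  have "(LINT \<omega>:{-pi..pi}|lebesgue. f \<omega> * \<bar>cos \<omega> - cos \<nu>\<bar>) \<le> (LINT \<omega>:{-pi..pi}|lebesgue. 5 / 2 * sqrt \<delta> + sqrt \<delta> / 2 * f \<omega>)"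
  proof (rule set_integral_mono[OF _ _ f_cos])
    show "set_integrable lebesgue {-pi..pi} (\<lambda>\<omega>. f \<omega> * \<bar>cos \<omega> - cos \<nu>\<bar>)"
      using set_integrable_bounded_scaleR[OF f_int, of "\<lambda>\<omega>. \<bar>cos \<omega> - cos \<nu>\<bar>" 2]
      by (simp add: continuous_intros abs_cos_diff_le_2)
    show "set_integrable lebesgue {-pi..pi} (\<lambda>\<omega>. 5 / 2 * sqrt \<delta> + sqrt \<delta> / 2 * f \<omega>)"
      by (intro set_integral_add set_integrable_mult_right f_int absolutely_integrable_continuous_real continuous_intros)
  qed
  also have "\<dots> = (LINT \<omega>:{-pi..pi}|lebesgue. 5 / 2 * sqrt \<delta>) + sqrt \<delta> / 2"
    by (subst set_integral_add) (simp_all add: set_integrable_mult_right f_int f_1 absolutely_integrable_continuous_real)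
  also have "(LINT \<omega>:{-pi..pi}|lebesgue. 5 / 2 * sqrt \<delta>) = 5 * pi * sqrt \<delta>"
    by (simp add: set_lebesgue_integral_def)
  also have "5 * pi * sqrt \<delta> + sqrt \<delta> / 2 \<le> 17 * sqrt \<delta>"
  proof -
    have "5 * pi + 1 / 2 \<le> 17"
      using pi_less_4 pi_approx by simp
    then have "(5 * pi + 1 / 2) * sqrt \<delta> \<le> 17 * sqrt \<delta>"
      using \<delta> by (intro mult_right_mono) auto
    then show ?thesis by (simp add: algebra_simps)
  qed
  also note \<eta>\<delta>
  finally show ?thesis
    using f_AR2 by blast
qed

text \<open>As \<open>f m\<close> has mass one, an entry minus its limit is the integral of f (cos
  k\<omega> - cos k\<nu>) at lag k, bounded by the Lipschitz constant times the quantity that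
  concentration makes small.\<close>

lemma exists_AR2_cov_tendsto:
  assumes \<nu>: "0 < \<nu>" "\<nu> < pi"
  shows "\<exists>f. (\<forall>m::nat. f m \<in> spectral_densities_AR2) \<and>
    (\<lambda>m. cov_matrix (f m)) \<longlonglongrightarrow> (\<chi> j l. cos (\<nu> * (real (idx j) - real (idx l))) :: real^'n::{finite,linorder}^'n::{finite,linorder})"
proof -
  have "\<exists>f. f \<in> spectral_densities_AR2 \<and>
      (LINT \<omega>:{-pi..pi}|lebesgue. f \<omega> * \<bar>cos \<omega> - cos \<nu>\<bar>) \<le> 1 / real (Suc m)" for m
    using exists_AR2_concentrated[OF \<nu>, of "1 / real (Suc m)"] by auto
  then obtain f where f: "\<And>m. f m \<in> spectral_densities_AR2"
    and le: "\<And>m. (LINT \<omega>:{-pi..pi}|lebesgue. f m \<omega> * \<bar>cos \<omega> - cos \<nu>\<bar>) \<le> 1 / real (Suc m)"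
    by metis
  have int: "set_integrable lebesgue {-pi..pi} (f m)" and one: "(LINT \<omega>:{-pi..pi}|lebesgue. f m \<omega>) = 1"
    and nn: "\<And>\<omega>. \<omega> \<in> {-pi..pi} \<Longrightarrow> 0 \<le> f m \<omega>" for m
    using f[of m] by (auto simp: spectral_densities_AR2_def spectral_densities_def)
  have "(\<lambda>m. cov_matrix (f m) $ j $ l) \<longlonglongrightarrow> cos (\<nu> * (real (idx j) - real (idx l)))" for j l :: "'n::{finite,linorder}"
  proof -
    define k where "k = nat \<bar>int (idx j) - int (idx l)\<bar>"
    have k: "\<bar>real (idx j) - real (idx l)\<bar> = real k"
      by (simp add: k_def)
    have cos_k: "cos ((real (idx j) - real (idx l)) * x) = cos (real k * x)" for x
      using cos_abs_real[of "(real (idx j) - real (idx l)) * x"] cos_abs_real[of "real k * x"]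
      by (simp add: abs_mult k)
    obtain K where K: "0 \<le> K" "\<And>x y. \<bar>cos (real k * x) - cos (real k * y)\<bar> \<le> K * \<bar>cos x - cos y\<bar>"
      using cos_multiple_Lipschitz[of k] by blast
    have b: "norm (cov_matrix (f m) $ j $ l - cos (real k * \<nu>)) \<le> K * (1 / real (Suc m))" for m
    proof -
      have i1: "set_integrable lebesgue {-pi..pi} (\<lambda>\<omega>. f m \<omega> * cos (real k * \<omega>))"
        using set_integrable_bounded_scaleR[OF int, of "\<lambda>\<omega>. cos (real k * \<omega>)" 1] by (simp add: continuous_intros)
      have i2: "set_integrable lebesgue {-pi..pi} (\<lambda>\<omega>. f m \<omega> * \<bar>cos \<omega> - cos \<nu>\<bar>)"
        using set_integrable_bounded_scaleR[OF int, of "\<lambda>\<omega>. \<bar>cos \<omega> - cos \<nu>\<bar>" 2]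
        by (simp add: continuous_intros abs_cos_diff_le_2)
      have "cov_matrix (f m) $ j $ l - cos (real k * \<nu>) =
          (LINT \<omega>:{-pi..pi}|lebesgue. f m \<omega> * cos (real k * \<omega>)) - (LINT \<omega>:{-pi..pi}|lebesgue. cos (real k * \<nu>) * f m \<omega>)"
        by (simp add: cov_matrix_eq[OF int] cos_k one)
      also have "\<dots> = (LINT \<omega>:{-pi..pi}|lebesgue. f m \<omega> * cos (real k * \<omega>) - cos (real k * \<nu>) * f m \<omega>)"
        by (intro set_integral_diff(2)[symmetric] i1 set_integrable_mult_right int)
      also have "norm \<dots> \<le> (LINT \<omega>:{-pi..pi}|lebesgue. norm (f m \<omega> * cos (real k * \<omega>) - cos (real k * \<nu>) * f m \<omega>))"
        by (intro set_integral_norm_bound set_integral_diff i1 set_integrable_mult_right int)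
      also have "\<dots> \<le> (LINT \<omega>:{-pi..pi}|lebesgue. K * (f m \<omega> * \<bar>cos \<omega> - cos \<nu>\<bar>))"
      proof (intro set_integral_mono set_integrable_norm set_integral_diff i1 set_integrable_mult_right int i2)
        fix \<omega>
        assume "\<omega> \<in> {-pi..pi}"
        have "f m \<omega> * cos (real k * \<omega>) - cos (real k * \<nu>) * f m \<omega> = f m \<omega> * (cos (real k * \<omega>) - cos (real k * \<nu>))"
          by (simp add: algebra_simps)
        then have "norm (f m \<omega> * cos (real k * \<omega>) - cos (real k * \<nu>) * f m \<omega>) = f m \<omega> * \<bar>cos (real k * \<omega>) - cos (real k * \<nu>)\<bar>"
          using nn[OF \<open>\<omega> \<in> _\<close>, of m] by (simp add: abs_mult)
        also have "\<dots> \<le> f m \<omega> * (K * \<bar>cos \<omega> - cos \<nu>\<bar>)"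
          using nn[OF \<open>\<omega> \<in> _\<close>] K(2) by (intro mult_left_mono)
        finally show "norm (f m \<omega> * cos (real k * \<omega>) - cos (real k * \<nu>) * f m \<omega>) \<le> K * (f m \<omega> * \<bar>cos \<omega> - cos \<nu>\<bar>)"
          by (simp only: mult_ac)
      qed
      also have "\<dots> \<le> K * (1 / real (Suc m))"
        unfolding set_integral_mult_right using le[of m] K(1) by (rule mult_left_mono)
      finally show ?thesis .
    qed
    have "(\<lambda>m. K * (1 / real (Suc m))) \<longlonglongrightarrow> 0"
      using tendsto_mult_right_zero[OF LIMSEQ_inverse_real_of_nat] by (simp only: inverse_eq_divide)
    with b have "(\<lambda>m. cov_matrix (f m) $ j $ l - cos (real k * \<nu>)) \<longlonglongrightarrow> 0"
      by (rule Lim_null_comparison[OF always_eventually[OF allI]])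
    then have "(\<lambda>m. cov_matrix (f m) $ j $ l) \<longlonglongrightarrow> cos (real k * \<nu>)"
      by (rule LIM_zero_cancel)
    then show ?thesis
      by (simp only: mult.commute[of \<nu>] cos_k)
  qed
  then have "(\<lambda>m. cov_matrix (f m)) \<longlonglongrightarrow> (\<chi> j l. cos (\<nu> * (real (idx j) - real (idx l))) :: real^'n::{finite,linorder}^'n::{finite,linorder})"
    by (intro vec_tendstoI) simp
  with f show ?thesis by blast
qed

section \<open>Power along the concentrating mixtures\<close>

lemma idx_less_iff: "idx i < idx j \<longleftrightarrow> i < (j :: 'a::{finite,linorder})"
proof -
  have "idx i < idx j" if "i < j" for i j :: 'a
    unfolding idx_def using that by (intro psubset_card_mono) auto
  then show ?thesis
    by (metis less_asym linorder_neqE)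
qed

text \<open>The binomial theorem expands the centered power in the columns of degree 0, ..., m, with
  coefficient one at degree m. Degree i sits in column i + 1, so all columns of degree below p
  precede \<open>i0\<close> and are killed by \<open>R\<close>; only m = p reaches
  \<open>i0\<close>.\<close>

lemma centered_monomial_in_trend:
  fixes X :: "real^'k::{finite,linorder}^'n::{finite,linorder}" and R :: "real^'k::{finite,linorder}^'q"
  assumes poly: "polynomial_trend kF X" and i0: "idx i0 \<le> kF" "idx i0 = Suc p"
    and zero: "\<And>i. i < i0 \<Longrightarrow> column i R = 0" and m: "m \<le> p"
  shows "\<exists>\<eta>. X *v \<eta> = centered_monomial m \<and> R *v \<eta> = (if m = p then column i0 R else 0)"
proof -
  have "\<exists>j :: 'k. idx j = Suc i" if "i \<le> p" for i
  proof -
    have "Suc i \<in> range (idx :: 'k \<Rightarrow> nat)"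
      using bij_betw_idx[where 'a = 'k] that i0(2) by (auto simp: bij_betw_def) (metis atLeastAtMost_iff order_trans rangeI Suc_le_mono)
    then show ?thesis by (metis rangeE)
  qed
  then obtain j :: "nat \<Rightarrow> 'k" where j: "\<And>i. i \<le> p \<Longrightarrow> idx (j i) = Suc i"
    by metis
  define \<tau> where "\<tau> = (real CARD('n) + 1) / 2"
  define \<eta> where "\<eta> = (\<Sum>i\<le>m. (of_nat (m choose i) * (- \<tau>) ^ (m - i)) *\<^sub>R axis (j i) (1 :: real))"
  have mult: "A *v \<eta> = (\<Sum>i\<le>m. (of_nat (m choose i) * (- \<tau>) ^ (m - i)) *\<^sub>R column (j i) A)" for A :: "real^'k::{finite,linorder}^'b"
    unfolding \<eta>_def by (simp add: linear_sum[OF matrix_vector_mul_linear] linear_scale[OF matrix_vector_mul_linear] matrix_vector_mult_basis)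
  have "X *v \<eta> = centered_monomial m"
  proof -
    have "(X *v \<eta>) $ t = centered t ^ m" for t
    proof -
      have "(X *v \<eta>) $ t = (\<Sum>i\<le>m. of_nat (m choose i) * (- \<tau>) ^ (m - i) * X $ t $ j i)"
        by (simp add: mult column_def)
      also have "\<dots> = (\<Sum>i\<le>m. of_nat (m choose i) * real (idx t) ^ i * (- \<tau>) ^ (m - i))"
      proof (rule sum.cong)
        fix i assume "i \<in> {..m}"
        then have "idx (j i) = Suc i" "idx (j i) \<le> kF"
          using j[of i] m i0 by auto
        then show "of_nat (m choose i) * (- \<tau>) ^ (m - i) * X $ t $ j i = of_nat (m choose i) * real (idx t) ^ i * (- \<tau>) ^ (m - i)"
          using poly by (simp add: polynomial_trend_def)
      qed simp
      also have "\<dots> = (real (idx t) + - \<tau>) ^ m"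
        by (rule binomial_ring[symmetric])
      finally show ?thesis
        by (simp add: centered_def \<tau>_def)
    qed
    then show ?thesis
      by (simp add: vec_eq_iff centered_monomial_def)
  qed
  moreover have "R *v \<eta> = (if m = p then column i0 R else 0)"
  proof -
    have "R *v \<eta> = (\<Sum>i\<le>m. if i = p then (of_nat (m choose i) * (- \<tau>) ^ (m - i)) *\<^sub>R column (j i) R else 0)"
      unfolding mult
    proof (rule sum.cong)
      fix i assume "i \<in> {..m}"
      then have "column (j i) R = 0" if "i \<noteq> p"
        using that j[of i] m i0 zero[of "j i"] by (simp add: idx_less_iff[symmetric])
      then show "(of_nat (m choose i) * (- \<tau>) ^ (m - i)) *\<^sub>R column (j i) R =
          (if i = p then (of_nat (m choose i) * (- \<tau>) ^ (m - i)) *\<^sub>R column (j i) R else 0)"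
        by simp
    qed simp
    moreover have "j p = i0"
      using j[of p] i0 by (simp add: inj_idx[symmetric])
    ultimately show ?thesis
      using m by auto
  qed
  ultimately show ?thesis
    by blast
qed

lemma AE_inner_nonzero:
  fixes a :: "'a::euclidean_space"
  assumes "a \<noteq> 0"
  shows "AE z in lborel. a \<bullet> z \<noteq> 0"
proof -
  have "{z. a \<bullet> z = 0} \<in> null_sets lebesgue"
    using negligible_hyperplane[of a 0] assms by (simp add: negligible_iff_null_sets)
  moreover have "{z. a \<bullet> z = 0} \<in> sets lborel"
    by (simp add: closed_hyperplane borel_closed)
  ultimately have "{z. a \<bullet> z = 0} \<in> null_sets lborel"
    by (auto simp: null_sets_def)
  then show ?thesis
    by (rule AE_I'[of _ lborel]) auto
qed

text \<open>Up to the factor \<sigma>\<gamma> and a regression component, the observation is a point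
  \<open>y k\<close> that tends to \<open>z\<close>. Equivariance therefore turns the statistic into
  the form at \<open>y k\<close> with the diverging offset
  \<open>l k *\<^sub>R column i0 R\<close>.\<close>

lemma F_type_stat_eventually_ge:
  fixes X :: "real^'k::{finite,linorder}^'n::{finite,linorder}" and R :: "real^'k::{finite,linorder}^'q"
  assumes est: "estimator_conditions X \<beta> \<Omega> N"
    and poly: "polynomial_trend kF X" and i0: "idx i0 \<le> kF" "idx i0 = Suc p"
    and zero: "\<And>i. i < i0 \<Longrightarrow> column i R = 0"
    and \<beta>0: "R *v \<beta>0 = r" and \<sigma>: "0 < \<sigma>" and x: "\<And>k. 0 < x k" "\<And>k. x k \<le> 1" "x \<longlonglongrightarrow> 0"
    and z: "z \<notin> Nstar \<Omega> N" "0 < column i0 R \<bullet> (matrix_inv (\<Omega> z) *v column i0 R)"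
    and z01: "centered_monomial 0 \<bullet> z \<noteq> 0" "centered_monomial 1 \<bullet> z \<noteq> 0"
  shows "eventually (\<lambda>k. C \<le> F_type_stat R r \<beta> \<Omega> N
    (X *v \<beta>0 + (\<sigma> *\<^sub>R trend_root ((x k)\<^sup>2) (x k ^ (2 * p + 1))) *v z)) sequentially"
proof -
  define \<nu> where "\<nu> k = (x k)\<^sup>2" for k
  define \<gamma> where "\<gamma> k = x k ^ (2 * p + 1)" for k
  define a where "a k = rank1_gain (\<gamma> k) (cos_vec (\<nu> k) :: real^'n::{finite,linorder}) * (cos_vec (\<nu> k) \<bullet> z)" for k
  define b where "b k = rank1_gain (\<gamma> k) (sin_vec (\<nu> k) :: real^'n::{finite,linorder}) * (sin_vec (\<nu> k) \<bullet> z)" for k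
  define c where "c k m = a k * cos_coeff m + b k * sin_coeff m" for k m
  define y where "y k = z + (1 / \<gamma> k) *\<^sub>R trend_remainder p (\<nu> k) (a k) (b k)" for k
  define l where "l k = c k p * inverse (x k)" for k
  have \<gamma>: "0 < \<gamma> k" "\<gamma> k \<le> 1" for k
    using x(1)[of k] x(2)[of k] power_le_one[of "x k" "2 * p + 1"] by (simp_all add: \<gamma>_def)
  have ab: "\<bar>a k\<bar> \<le> norm z" "\<bar>b k\<bar> \<le> norm z" for k
    using abs_rank1_gain_le[of "\<gamma> k"] \<gamma>[of k] by (auto simp: a_def b_def less_imp_le)
  have "(\<lambda>k. (1 / \<gamma> k) *\<^sub>R trend_remainder p (\<nu> k) (a k) (b k) :: real^'n::{finite,linorder}) \<longlonglongrightarrow> 0"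
    unfolding \<gamma>_def \<nu>_def by (rule tendsto_trend_remainder[OF x(1,3) ab])
  then have y: "y \<longlonglongrightarrow> z"
    unfolding y_def using tendsto_add[OF tendsto_const[of z]] by fastforce
  \<comment> \<open>Divergence holds in absolute value only: the sign of \<open>c0\<close> depends
    on \<open>z\<close>, and the quadratic form does not see it.\<close>
  have l: "filterlim l at_infinity sequentially"
  proof -
    obtain c0 where c0: "c0 \<noteq> 0" "(\<lambda>k. c k p) \<longlonglongrightarrow> c0"
      using leading_coefficient_tendsto[OF x(1,3) z01, of p] unfolding c_def a_def b_def \<gamma>_def \<nu>_def by blast
    have "filterlim x (at 0) sequentially"
      using x(1,3) by (auto simp: filterlim_at less_imp_neq[THEN not_sym])
    then have "filterlim (\<lambda>k. inverse (x k)) at_infinity sequentially"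
      by (rule filterlim_compose[OF filterlim_inverse_at_infinity])
    with c0 show ?thesis
      unfolding l_def by (intro tendsto_mult_filterlim_at_infinity)
  qed
  have est': "closed N" "continuous_on (- N) \<beta>" "continuous_on (- N) \<Omega>"
    using est by (simp_all add: estimator_conditions_def)
  have open_N: "open (- Nstar \<Omega> N)"
    using closed_Nstar[OF est'(1,3)] by (simp add: open_closed)
  have sub: "- Nstar \<Omega> N \<subseteq> - N"
    by (auto simp: Nstar_def)
  have "eventually (\<lambda>k. C \<le> (R *v \<beta> (y k) + l k *\<^sub>R column i0 R) \<bullet>
      (matrix_inv (\<Omega> (y k)) *v (R *v \<beta> (y k) + l k *\<^sub>R column i0 R))) sequentially"
    using z
    by (intro quadratic_form_diverges[OF open_N, of z "\<lambda>y. R *v \<beta> y" \<Omega>] y l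
        bounded_linear.continuous_on[OF matrix_vector_mul_bounded_linear]
        continuous_on_subset[OF est'(2) sub] continuous_on_subset[OF est'(3) sub])
      (auto simp: Nstar_def)
  \<comment> \<open>\<open>Nstar\<close> is closed, so late \<open>y k\<close> avoid it and the
    default value 0 of the statistic does not interfere.\<close>
  moreover have "eventually (\<lambda>k. y k \<in> - Nstar \<Omega> N) sequentially"
    using y open_N z(1) by (intro topological_tendstoD) auto
  ultimately show ?thesis
  proof eventually_elim
    case (elim k)
    have "\<exists>\<eta>. \<forall>m\<le>p. X *v \<eta> m = centered_monomial m \<and> R *v \<eta> m = (if m = p then column i0 R else 0)"
      using centered_monomial_in_trend[OF poly i0 zero] by metis
    then obtain \<eta> where \<eta>: "\<And>m. m \<le> p \<Longrightarrow> X *v \<eta> m = centered_monomial m"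
      "\<And>m. m \<le> p \<Longrightarrow> R *v \<eta> m = (if m = p then column i0 R else 0)"
      by blast
    \<comment> \<open>The monomial part of the trend in regression coordinates; \<open>R\<close>
      sees its last term only.\<close>
    define \<theta>' where "\<theta>' = (\<Sum>m<p. (c k m * \<nu> k ^ m / \<gamma> k) *\<^sub>R \<eta> m) + l k *\<^sub>R \<eta> p"
    define \<theta> where "\<theta> = \<beta>0 + (\<sigma> * \<gamma> k) *\<^sub>R \<theta>'"
    note lin = linear_sum[OF matrix_vector_mul_linear] linear_scale[OF matrix_vector_mul_linear] matrix_vector_right_distrib
    have "R *v \<theta>' = l k *\<^sub>R column i0 R"
      by (simp add: \<theta>'_def lin \<eta>)
    then have "R *v \<theta> = r + (\<sigma> * \<gamma> k) *\<^sub>R (l k *\<^sub>R column i0 R)"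
      by (simp add: \<theta>_def lin \<beta>0)
    moreover have "X *v \<beta>0 + (\<sigma> *\<^sub>R trend_root ((x k)\<^sup>2) (x k ^ (2 * p + 1))) *v z = (\<sigma> * \<gamma> k) *\<^sub>R y k + X *v \<theta>"
    proof -
      have "trend_root ((x k)\<^sup>2) (x k ^ (2 * p + 1)) *v z = \<gamma> k *\<^sub>R (y k + (\<Sum>m<p. (c k m * \<nu> k ^ m / \<gamma> k) *\<^sub>R centered_monomial m)
          + l k *\<^sub>R centered_monomial p)"
        using trend_root_decomposition[OF x(1)[of k], of p z]
        unfolding \<nu>_def \<gamma>_def a_def b_def c_def y_def l_def by (simp add: divide_inverse)
      also have "\<dots> = \<gamma> k *\<^sub>R (y k + X *v \<theta>')"
        by (simp add: \<theta>'_def lin \<eta> add.assoc)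
      finally show ?thesis
        by (simp add: \<theta>_def lin scaleR_matrix_vector_assoc[symmetric] scaleR_right_distrib)
    qed
    moreover have "\<sigma> * \<gamma> k \<noteq> 0"
      using \<sigma> \<gamma>[of k] by simp
    ultimately show ?case
      using elim F_type_stat_equivariance[OF est, of "y k" "\<sigma> * \<gamma> k" R \<theta> r "l k *\<^sub>R column i0 R"] by simp
  qed
qed

text \<open>For fixed \<nu> and \<gamma>, concentrating AR(2) densities mixed with white noise of
  weight \<gamma>^2 have scaled covariances that tend to the nonsingular matrix L L'. The bound
  survives this limit, and L then serves as the map from the common standard Gaussian.\<close>

lemma emeasure_gaussian_mixture_le:
  fixes \<mu> :: "real^'n::{finite,linorder}"
  assumes \<nu>: "0 < \<nu>" "\<nu> < pi" and \<gamma>: "0 < \<gamma>" "\<gamma> \<le> 1" and \<sigma>: "0 < \<sigma>" and B: "B \<in> sets borel"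
    and le: "\<And>f. f \<in> spectral_densities_AR2_ext \<Longrightarrow> emeasure (gaussian \<mu> (\<sigma>\<^sup>2 *\<^sub>R cov_matrix f)) B \<le> s"
  shows "emeasure (gaussian 0 (mat 1)) {z. \<mu> + (\<sigma> *\<^sub>R trend_root \<nu> \<gamma>) *v z \<in> B} \<le> s"
proof -
  let ?L = "\<sigma> *\<^sub>R trend_root \<nu> \<gamma> :: real^'n::{finite,linorder}^'n::{finite,linorder}"
  let ?E = "\<chi> j l. cos (\<nu> * (real (idx j) - real (idx l))) :: real^'n::{finite,linorder}^'n::{finite,linorder}"
  obtain f where f: "\<And>m::nat. f m \<in> spectral_densities_AR2" and lim: "(\<lambda>m. cov_matrix (f m)) \<longlonglongrightarrow> ?E"
    using exists_AR2_cov_tendsto[OF \<nu>] by blast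
  let ?g = "\<lambda>m. \<lambda>\<omega>\<in>{-pi..pi}. (1 - \<gamma>\<^sup>2) * f m \<omega> + \<gamma>\<^sup>2 / (2 * pi)"
  have \<gamma>1: "0 \<le> 1 - \<gamma>\<^sup>2"
    using \<gamma> by (simp add: power_le_one)
  have g: "?g m \<in> spectral_densities_AR2_ext" for m
    unfolding spectral_densities_AR2_ext_def mem_Collect_eq using f[of m] \<gamma>1
    by (intro exI[of _ "f m"] exI[of _ "1 - \<gamma>\<^sup>2"] exI[of _ "\<gamma>\<^sup>2"]) simp
  have cov: "cov_matrix (?g m) = (1 - \<gamma>\<^sup>2) *\<^sub>R cov_matrix (f m) + \<gamma>\<^sup>2 *\<^sub>R (mat 1 :: real^'n::{finite,linorder}^'n::{finite,linorder})" for m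
    using f[of m] by (intro cov_matrix_mixture) (simp add: spectral_densities_AR2_def spectral_densities_def)
  have inv: "invertible ?L"
    using \<sigma> invertible_trend_root[OF \<gamma>] by (intro scalar_invertible) auto
  have LL: "?L ** transpose ?L = \<sigma>\<^sup>2 *\<^sub>R ((1 - \<gamma>\<^sup>2) *\<^sub>R ?E + \<gamma>\<^sup>2 *\<^sub>R mat 1)"
    using trend_root_square[of \<gamma> \<nu>, where 'n = 'n] \<gamma>
    by (simp add: transpose_scalar matrix_scalar_ac scalar_matrix_assoc[symmetric] power2_eq_square)
  have "(\<lambda>m. \<sigma>\<^sup>2 *\<^sub>R cov_matrix (?g m)) \<longlonglongrightarrow> ?L ** transpose ?L"
    unfolding LL cov by (intro tendsto_intros lim)
  moreover have "det (?L ** transpose ?L) \<noteq> 0"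
    using inv by (simp add: det_mul invertible_det_nz)
  ultimately have "emeasure (gaussian \<mu> (?L ** transpose ?L)) B \<le> s"
    using B le[OF g] by (rule emeasure_gaussian_limit_le)
  moreover have "(\<lambda>z. \<mu> + ?L *v z) \<in> borel_measurable borel"
    by (intro borel_measurable_continuous_onI continuous_intros)
  ultimately show ?thesis
    unfolding gaussian_congruence[OF inv] using B
    by (subst (asm) emeasure_distr) (auto simp: gaussian_def vimage_def)
qed

theorem theorem5p2:
  fixes X :: "real^'k::{finite,linorder}^'n::{finite,linorder}"
    and R :: "real^'k::{finite,linorder}^'q::finite"
    and r :: "real^'q"
    and FF :: "(real \<Rightarrow> real) set"
    and kF :: nat
    and \<beta> :: "real^'n::{finite,linorder} \<Rightarrow> real^'k::{finite,linorder}"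
    and \<Omega> :: "real^'n::{finite,linorder} \<Rightarrow> real^'q^'q"
    and N :: "(real^'n::{finite,linorder}) set"
    and C \<sigma>2 :: real
    and \<mu>0 :: "real^'n::{finite,linorder}"
  assumes "CARD('k) < CARD('n)"
    and "rank X = CARD('k)"
    and "rank R = CARD('q)"
    and "FF \<subseteq> spectral_densities"
    and "spectral_densities_AR2_ext \<subseteq> FF"
    and "1 \<le> kF" and "kF \<le> CARD('k)"
    and "polynomial_trend kF X"
    and "\<exists>i. idx i \<le> kF \<and> column i R \<noteq> 0"
    and "estimator_conditions X \<beta> \<Omega> N"
    and "\<And>v :: real^'q. v \<noteq> 0 \<Longrightarrow>
           {y. y \<notin> Nstar \<Omega> N \<and> v \<bullet> (matrix_inv (\<Omega> y) *v v) = 0} \<in> null_sets lborel"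
    and "\<mu>0 \<in> null_means X R r"
    and "0 < \<sigma>2"
  shows "measure (gaussian 0 (mat 1)) {y. y \<notin> N \<and> nonneg_definite (\<Omega> y)}
           \<le> measure (gaussian 0 (mat 1))
               {y. y \<notin> Nstar \<Omega> N \<and>
                   0 \<le> first_nonzero_column R \<bullet> (matrix_inv (\<Omega> y) *v first_nonzero_column R)}
         \<and> measure (gaussian 0 (mat 1))
               {y. y \<notin> Nstar \<Omega> N \<and>
                   0 \<le> first_nonzero_column R \<bullet> (matrix_inv (\<Omega> y) *v first_nonzero_column R)}
           \<le> (SUP f\<in>FF. measure (gaussian \<mu>0 (\<sigma>2 *\<^sub>R cov_matrix f)) {y. C \<le> F_type_stat R r \<beta> \<Omega> N y})"
proof (intro conjI)
  interpret prob_space "gaussian 0 (mat 1 :: real^'n::{finite,linorder}^'n::{finite,linorder})"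
    by (rule prob_space_std_gaussian)
  let ?P = "gaussian 0 (mat 1 :: real^'n::{finite,linorder}^'n::{finite,linorder})"
  let ?e = "first_nonzero_column R"
  let ?D = "{y. y \<notin> Nstar \<Omega> N \<and> 0 \<le> ?e \<bullet> (matrix_inv (\<Omega> y) *v ?e)}"
  note est = assms(10)
  have est': "closed N" "continuous_on (- N) \<beta>" "continuous_on (- N) \<Omega>"
    "N \<in> null_sets lborel" "AE y in lborel. y \<notin> N \<longrightarrow> invertible (\<Omega> y)"
    using est by (simp_all add: estimator_conditions_def)
  have D: "?D \<in> sets borel"
    by (rule borel_inv_quadratic_form_nonneg[OF est'(1,3)])
  have setsP: "sets ?P = sets borel"
    by (simp add: gaussian_def)
  \<comment> \<open>Off a null set \<open>\<Omega> y\<close> is invertible, and inversion preserves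
    nonnegativity of the form.\<close>
  show "measure ?P {y. y \<notin> N \<and> nonneg_definite (\<Omega> y)} \<le> measure ?P ?D"
  proof (rule finite_measure_mono_AE)
    show "AE y in ?P. y \<in> {y. y \<notin> N \<and> nonneg_definite (\<Omega> y)} \<longrightarrow> y \<in> ?D"
      using AE_gaussian[OF est'(5)]
    proof eventually_elim
      case (elim y)
      then show ?case
        using nonneg_definite_matrix_inv[of "\<Omega> y" ?e] by (auto simp: Nstar_def invertible_det_nz)
    qed
    show "?D \<in> sets ?P"
      using D by (simp add: setsP)
  qed
  define i0 where "i0 = Min {i. column i R \<noteq> 0}"
  obtain i where i: "idx i \<le> kF" "column i R \<noteq> 0"
    using assms(9) by blast
  have "i0 \<in> {i. column i R \<noteq> 0}"
    unfolding i0_def by (rule Min_in) (use i in auto)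
  then have e: "?e = column i0 R" and e0: "?e \<noteq> 0"
    by (simp_all add: first_nonzero_column_def i0_def)
  have zero: "column j R = 0" if "j < i0" for j
    using that Min_le[of "{i. column i R \<noteq> 0}" j] unfolding i0_def by fastforce
  have "i0 \<le> i"
    unfolding i0_def using i by (intro Min_le) auto
  then have i0: "idx i0 \<le> kF"
    using i(1) idx_less_iff[of i i0] by (meson leD not_le_imp_less order_trans)
  have "0 < idx i0"
    by (auto simp: idx_def card_gt_0_iff)
  then obtain p where p: "idx i0 = Suc p"
    using gr0_implies_Suc by blast
  obtain \<beta>0 where \<beta>0: "\<mu>0 = X *v \<beta>0" "R *v \<beta>0 = r"
    using assms(12) by (auto simp: null_means_def)
  define B where "B = {y. C \<le> F_type_stat R r \<beta> \<Omega> N y}"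
  have B: "B \<in> sets borel"
    using borel_measurable_F_type_stat[OF est'(1,2,3), of R r] unfolding B_def by measurable
  let ?Q = "\<lambda>f. gaussian \<mu>0 (\<sigma>2 *\<^sub>R cov_matrix f)"
  have Q1: "emeasure (?Q f) B \<le> 1" if "f \<in> FF" for f
  proof -
    have "nonneg_definite (cov_matrix f :: real^'n::{finite,linorder}^'n::{finite,linorder})"
      using that assms(4) by (intro nonneg_definite_cov_matrix) (auto simp: spectral_densities_def)
    then have "nonneg_definite (\<sigma>2 *\<^sub>R cov_matrix f :: real^'n::{finite,linorder}^'n::{finite,linorder})"
      using assms(13) by (simp add: nonneg_definite_def transpose_scalar scaleR_matrix_vector_assoc[symmetric])
    then show ?thesis
      by (rule emeasure_gaussian_le_1)
  qed
  then have measure_Q1: "measure (?Q f) B \<le> 1" if "f \<in> FF" for f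
    using that by (simp add: measure_def enn2real_leI)
  define s where "s = (SUP f\<in>FF. measure (?Q f) B)"
  have Qs: "emeasure (?Q f) B \<le> ennreal s" if "f \<in> spectral_densities_AR2_ext" for f
  proof -
    have f: "f \<in> FF"
      using that assms(5) by blast
    have "emeasure (?Q f) B = ennreal (measure (?Q f) B)"
      using Q1[OF f] by (intro emeasure_eq_ennreal_measure) (auto simp: top_unique)
    also have "measure (?Q f) B \<le> s"
      unfolding s_def using measure_Q1 f by (intro cSUP_upper) (auto intro!: bdd_aboveI[of _ 1])
    finally show ?thesis
      by (simp add: ennreal_leI)
  qed
  \<comment> \<open>A null sequence in (0, 1] ensures \<gamma> \<le> 1 and \<nu> = x^2 \<le> 1 < pi,
    as the mixture bound requires.\<close>
  define x where "x k = 1 / (real k + 1)" for k :: nat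
  have x: "0 < x k" "x k \<le> 1" for k
    by (simp_all add: x_def)
  have x_lim: "x \<longlonglongrightarrow> 0"
    using LIMSEQ_inverse_real_of_nat by (simp add: x_def[abs_def] inverse_eq_divide add.commute)
  let ?B = "\<lambda>k. {z. \<mu>0 + (sqrt \<sigma>2 *\<^sub>R trend_root ((x k)\<^sup>2) (x k ^ (2 * p + 1))) *v z \<in> B}"
  \<comment> \<open>With at least two observations the centered linear trend is nonzero, so its
    orthogonal complement is a null set.\<close>
  have n: "1 < CARD('n)"
    using assms(1) zero_less_card_finite[where 'a = 'k] by linarith
  have "emeasure ?P ?D \<le> ennreal s"
  proof (rule emeasure_le_eventually)
    show "?D \<in> sets ?P"
      using D by (simp add: setsP)
    fix k
    have "(\<lambda>z. \<mu>0 + (sqrt \<sigma>2 *\<^sub>R trend_root ((x k)\<^sup>2) (x k ^ (2 * p + 1))) *v z) \<in> borel_measurable borel"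
      by (intro borel_measurable_continuous_onI continuous_intros)
    from measurable_sets_borel[OF this B] show "?B k \<in> sets ?P"
      by (simp add: setsP vimage_def)
    have "x k ^ (2 * p + 1) \<le> 1"
      using x[of k] by (intro power_le_one) auto
    moreover have "(x k)\<^sup>2 < pi"
      using x[of k] power_le_one[of "x k" 2] pi_gt3 by simp
    ultimately show "emeasure ?P (?B k) \<le> ennreal s"
      using x[of k] assms(13) B Qs by (intro emeasure_gaussian_mixture_le) auto
  next
    have a0: "(centered_monomial 0 :: real^'n::{finite,linorder}) \<noteq> 0"
      by (simp add: vec_eq_iff centered_monomial_def)
    have a1: "(centered_monomial 1 :: real^'n::{finite,linorder}) \<noteq> 0"
    proof -
      have "1 \<in> range (idx :: 'n \<Rightarrow> nat)"
        using bij_betw_idx[where 'a = 'n] n by (auto simp: bij_betw_def)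
      then obtain t :: 'n where "idx t = 1"
        by (metis rangeE)
      then have "centered t \<noteq> 0"
        using n by (simp add: centered_def)
      then show ?thesis
        by (auto simp: vec_eq_iff centered_monomial_def)
    qed
    have null: "AE y in lborel. \<not> (y \<notin> Nstar \<Omega> N \<and> ?e \<bullet> (matrix_inv (\<Omega> y) *v ?e) = 0)"
      using AE_not_in[OF assms(11)[OF e0]] by simp
    show "AE z in ?P. z \<in> ?D \<longrightarrow> eventually (\<lambda>k. z \<in> ?B k) sequentially"
      using AE_gaussian[OF null] AE_gaussian[OF AE_inner_nonzero[OF a0]] AE_gaussian[OF AE_inner_nonzero[OF a1]]
    proof eventually_elim
      case (elim z)
      show ?case
      proof
        assume "z \<in> ?D"
        then have "z \<notin> Nstar \<Omega> N" "0 < column i0 R \<bullet> (matrix_inv (\<Omega> z) *v column i0 R)"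
          using elim(1) by (auto simp: e[symmetric] less_le)
        from F_type_stat_eventually_ge[OF est assms(8) i0 p zero \<beta>0(2) _ x x_lim this elim(2,3), of "sqrt \<sigma>2" C]
        show "eventually (\<lambda>k. z \<in> ?B k) sequentially"
          using assms(13) by (simp add: B_def \<beta>0(1))
      qed
    qed
  qed
  \<comment> \<open>A negative \<open>s\<close> would be truncated to 0 by \<open>ennreal\<close>,
    so the return to the reals needs a member of \<open>FF\<close>; an AR(2) density with c2 = 0
    provides one.\<close>
  moreover have "0 \<le> s"
  proof -
    have "FF \<noteq> {}"
    proof -
      obtain f where "f \<in> spectral_densities_AR2"
        using exists_AR2_concentrated[of 1 1] pi_gt3 by auto
      then have "(\<lambda>\<omega>\<in>{-pi..pi}. 1 * f \<omega> + 0 / (2 * pi)) \<in> spectral_densities_AR2_ext"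
        unfolding spectral_densities_AR2_ext_def by fastforce
      then show ?thesis
        using assms(5) by blast
    qed
    then obtain f where f: "f \<in> FF"
      by blast
    have "0 \<le> measure (?Q f) B"
      by simp
    also have "\<dots> \<le> s"
      unfolding s_def using measure_Q1 f by (intro cSUP_upper) (auto intro!: bdd_aboveI[of _ 1])
    finally show ?thesis .
  qed
  ultimately show "measure ?P ?D \<le> (SUP f\<in>FF. measure (gaussian \<mu>0 (\<sigma>2 *\<^sub>R cov_matrix f)) {y. C \<le> F_type_stat R r \<beta> \<Omega> N y})"
    unfolding B_def[symmetric] s_def[symmetric] by (simp add: emeasure_eq_measure)
qed

end
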